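(* For every fixed finite poset $P$ with $e(P)=1$, there is a constant $\delta_P>0$ such that \[ \pi^+(P)\le 2-\delta_P . \] More explicitly, if $e(P)=1$ and $P$ embeds (as a weak subposet) into levels $\ell,\ell+1$ of $B_d$, where $0\le \ell<d$, then one may take \[ \delta_P=\frac1{2\left(\binom d\ell+\binom d{\ell+1}-1\right)}. \]
   Context: A family $\mathcal G$ of sets is a weak copy of a finite poset $(P,\leqslant)$ if there is a bijection $\psi:P\to\mathcal G$ such that $\psi(p)\subseteq\psi(p')$ whenever $p\leqslant p'$. A family $\mathcal F$ is (weak) $P$-free if no subfamily of it is a weak copy of $P$. $\mathrm{La}(n,P)$ is the maximum size of a weak $P$-free family $\mathcal F\subseteq 2^{[n]}$, and $\pi^+(P)=\limsup_{n\to\infty}\mathrm{La}(n,P)/\binom{n}{\lfloor n/2\rfloor}$. $e(P)$ is the maximum integer $k$ such that, for every $n$, the union of any $k$ consecutive layers of $2^{[n]}$ is weak $P$-free; a layer (level) of $2^{[n]}$ is $\binom{[n]}{s}=\{Y\subseteq[n]:|Y|=s\}$. $B_d=(2^{[d]},\subseteq)$ is the Boolean lattice. "$P$ embeds into levels $\ell,\ell+1$ of $B_d$" means that there is an injection $\varphi:P\to\binom{[d]}{\ell}\cup\binom{[d]}{\ell+1}$ with $\varphi(p)\subseteq\varphi(p')$ whenever $p\leqslant p'$ in $P$. *)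

theory Defs
  imports "HOL-Library.Extended_Real"
begin

text \<open>
  A finite poset is a finite carrier \<open>P\<close> with an order relation \<open>r\<close> such that
  \<open>partial_order_on P r\<close>; \<open>(p, q) \<in> r\<close> means \<open>p \<le> q\<close>.
\<close>

definition weak_copy :: "'a set \<Rightarrow> 'a rel \<Rightarrow> 'b set set \<Rightarrow> bool" where
  "weak_copy P r G \<longleftrightarrow>
     (\<exists>\<psi>. bij_betw \<psi> P G \<and> (\<forall>p\<in>P. \<forall>q\<in>P. (p, q) \<in> r \<longrightarrow> \<psi> p \<subseteq> \<psi> q))"

definition poset_free :: "'a set \<Rightarrow> 'a rel \<Rightarrow> 'b set set \<Rightarrow> bool" where
  "poset_free P r F \<longleftrightarrow> (\<forall>G\<subseteq>F. \<not> weak_copy P r G)"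

definition layer :: "nat \<Rightarrow> nat \<Rightarrow> nat set set" where
  "layer n s = {Y. Y \<subseteq> {1..n} \<and> card Y = s}"

definition La :: "nat \<Rightarrow> 'a set \<Rightarrow> 'a rel \<Rightarrow> nat" where
  "La n P r = Max {card F | F. F \<subseteq> Pow {1..n} \<and> poset_free P r F}"

definition pi_plus :: "'a set \<Rightarrow> 'a rel \<Rightarrow> ereal" where
  "pi_plus P r = limsup (\<lambda>n. ereal (real (La n P r) / real (n choose (n div 2))))"

text \<open>
  The layers of \<open>2\<^sup>[\<^sup>n\<^sup>]\<close> are those of rank \<open>0, \<dots>, n\<close>, so \<open>k\<close> consecutive ones start
  at some \<open>s\<close> with \<open>s + k \<le> n + 1\<close>.  For a finite nonempty poset the set below is finite (a long
  chain contains a weak copy of \<open>P\<close>) and contains \<open>0\<close>, so its \<open>Sup\<close> is its maximum; for the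
  empty poset it is empty and \<open>Sup\<close> yields \<open>0\<close>.
\<close>

definition e_poset :: "'a set \<Rightarrow> 'a rel \<Rightarrow> nat" where
  "e_poset P r =
     Sup {k. \<forall>n s. s + k \<le> n + 1 \<longrightarrow> poset_free P r (\<Union>i\<in>{s..<s + k}. layer n i)}"

definition embeds_in_levels :: "'a set \<Rightarrow> 'a rel \<Rightarrow> nat \<Rightarrow> nat \<Rightarrow> bool" where
  "embeds_in_levels P r d l \<longleftrightarrow>
     (\<exists>\<phi>. inj_on \<phi> P \<and> \<phi> ` P \<subseteq> layer d l \<union> layer d (l + 1) \<and>
          (\<forall>p\<in>P. \<forall>q\<in>P. (p, q) \<in> r \<longrightarrow> \<phi> p \<subseteq> \<phi> q))"

end

theory Submission
  imports Defs "HOL-Combinatorics.Permutations"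
begin

text \<open>
  Let \<open>F\<close> be \<open>P\<close>-free with all sizes in \<open>[m, n - m]\<close>, and let \<open>U\<close> be the members of \<open>F\<close> with at least
  \<open>|P|\<close> members of \<open>F\<close> below them, \<open>L = F - U\<close>.  Members of \<open>L\<close> have few members of \<open>F\<close> below, and
  members of \<open>U\<close> have few above, since otherwise two-level \<open>P\<close> embeds around such a member.  Hence, up to
  probability \<open>O(1/m)\<close>, a random full chain meets each of \<open>L\<close> and \<open>U\<close> at most once, and \<open>U\<close> not below
  \<open>L\<close>.  Let \<open>x\<close> and \<open>y\<close> be the probabilities that it misses \<open>L\<close> and \<open>U\<close>; the Lubell mass of \<open>F\<close> is about
  \<open>2 - x - y\<close>.

  The key point is that \<open>L\<close> is stable under exchanges.  Swapping two consecutive steps of a chain at level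
  \<open>i\<close> changes only its \<open>i\<close>-th set.  If the new set is in \<open>L\<close> and the old one is not, then typically the old
  chain misses \<open>L\<close>; and it does so for at most two values of \<open>i\<close>, because the new sets for \<open>i\<close> and \<open>i + 2\<close>
  are nested.  So the probabilities of losing \<open>L\<close> by an exchange at level \<open>i\<close> sum to at most \<open>2x + O(1/m)\<close>.

  Now place \<open>d\<close> random points next to a random chain \<open>Y\<^sub>0 \<subseteq> Y\<^sub>1 \<subseteq> \<dots>\<close> of the rest.  With
  probability at least \<open>1 - x - y - O(1/m)\<close> one \<open>l\<close>-set \<open>S\<close> and one \<open>(l + 1)\<close>-set \<open>T\<close> of these points have
  \<open>S \<union> Y\<^sub>t \<in> L\<close> and \<open>T \<union> Y\<^sub>u \<in> U\<close> for some \<open>t \<le> u\<close>.  The other \<open>l\<close>-sets and \<open>(l + 1)\<close>-sets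
  are reached through a spanning tree of exchanges, with total failure probability at most
  \<open>2x (C(d, l) - 1) + 2y (C(d, l + 1) - 1) + O(1/m)\<close>.  Success would yield a copy of \<open>P\<close>, so
  these bounds force \<open>x + y \<ge> \<delta> - O(1/m)\<close>.
\<close>

subsection \<open>Random permutations\<close>

text \<open>Expectation under a uniformly random permutation \<open>\<sigma>\<close>. The images of
  the prefixes \<open>{1..i}\<close> form a uniformly random full chain, and arguments of
  \<open>\<sigma>\<close> are thought of as positions along it.\<close>

definition perm_avg :: "nat \<Rightarrow> ((nat \<Rightarrow> nat) \<Rightarrow> real) \<Rightarrow> real" where
  "perm_avg n f = (\<Sum>\<sigma> | \<sigma> permutes {1..n}. f \<sigma>) / fact n"

abbreviation perm_prob :: "nat \<Rightarrow> ((nat \<Rightarrow> nat) \<Rightarrow> bool) \<Rightarrow> real" where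
  "perm_prob n Q \<equiv> perm_avg n (\<lambda>\<sigma>. of_bool (Q \<sigma>))"

definition lubell :: "nat \<Rightarrow> nat set set \<Rightarrow> real" where
  "lubell n F = (\<Sum>B\<in>F. 1 / real (n choose card B))"

lemma perm_avg_mono:
  assumes "\<And>\<sigma>. \<sigma> permutes {1..n} \<Longrightarrow> f \<sigma> \<le> g \<sigma>"
  shows "perm_avg n f \<le> perm_avg n g"
  unfolding perm_avg_def using assms by (intro divide_right_mono sum_mono) auto

lemma perm_avg_cong:
  assumes "\<And>\<sigma>. \<sigma> permutes {1..n} \<Longrightarrow> f \<sigma> = g \<sigma>"
  shows "perm_avg n f = perm_avg n g"
  using assms by (intro antisym perm_avg_mono) auto

lemma perm_avg_add: "perm_avg n (\<lambda>\<sigma>. f \<sigma> + g \<sigma>) = perm_avg n f + perm_avg n g"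
  by (simp add: perm_avg_def sum.distrib add_divide_distrib)

lemma perm_avg_diff: "perm_avg n (\<lambda>\<sigma>. f \<sigma> - g \<sigma>) = perm_avg n f - perm_avg n g"
  by (simp add: perm_avg_def sum_subtractf diff_divide_distrib)

lemma perm_avg_cmult: "perm_avg n (\<lambda>\<sigma>. c * f \<sigma>) = c * perm_avg n f"
  by (simp add: perm_avg_def sum_distrib_left)

lemma perm_avg_sum: "perm_avg n (\<lambda>\<sigma>. \<Sum>i\<in>I. f i \<sigma>) = (\<Sum>i\<in>I. perm_avg n (f i))"
  unfolding perm_avg_def by (subst sum.swap) (simp add: sum_divide_distrib)

lemma perm_avg_const: "perm_avg n (\<lambda>\<sigma>. c) = c"
  using card_permutations[of "{1..n}" n] by (simp add: perm_avg_def del: atLeastAtMost_iff One_nat_def)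

text \<open>Composing on the right renames positions, which serves for exchanges along the chain.
  Composing on the left, as in the next lemma, renames points of the ground set, which serves for
  uniformity.\<close>

lemma perm_avg_compose_right:
  assumes "\<tau> permutes {1..n}"
  shows "perm_avg n (\<lambda>\<sigma>. f (\<sigma> \<circ> \<tau>)) = perm_avg n f"
  unfolding perm_avg_def using sum_permutations_compose_right[OF assms, of f] by simp

lemma perm_avg_compose_left:
  assumes "\<tau> permutes {1..n}"
  shows "perm_avg n (\<lambda>\<sigma>. f (\<tau> \<circ> \<sigma>)) = perm_avg n f"
  unfolding perm_avg_def using setum_permutations_compose_left[OF assms, of f] by simp

text \<open>\<open>X\<close> and its image have complements of equal size in \<open>B\<close>, so
  any bijection between these complements completes \<open>f\<close>.\<close>

lemma permutes_extend_inj_on: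
  assumes "finite B" "X \<subseteq> B" "inj_on f X" "f ` X \<subseteq> B"
  obtains \<tau> where "\<tau> permutes B" "\<And>x. x \<in> X \<Longrightarrow> \<tau> x = f x"
proof -
  have "card (B - X) = card (B - f ` X)"
    using assms by (simp add: card_Diff_subset finite_subset card_image)
  then obtain g where g: "bij_betw g (B - X) (B - f ` X)"
    using assms(1) by (meson finite_Diff finite_same_card_bij)
  define \<tau> where "\<tau> x = (if x \<in> X then f x else if x \<in> B then g x else x)" for x
  have "bij_betw \<tau> X (f ` X)"
    using assms(3) by (auto simp: bij_betw_def \<tau>_def inj_on_def)
  moreover have "bij_betw \<tau> (B - X) (B - f ` X)"
    using g by (rule bij_betw_cong[THEN iffD1, rotated]) (auto simp: \<tau>_def)
  ultimately have "bij_betw \<tau> (X \<union> (B - X)) (f ` X \<union> (B - f ` X))"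
    by (rule bij_betw_combine) auto
  moreover have "X \<union> (B - X) = B" "f ` X \<union> (B - f ` X) = B"
    using assms by auto
  ultimately have "bij_betw \<tau> B B" by simp
  then have "\<tau> permutes B"
    by (rule bij_imp_permutes) (use assms(2) in \<open>auto simp: \<tau>_def\<close>)
  then show ?thesis
    by (rule that) (simp add: \<tau>_def)
qed

lemma permutes_mapping_subset:
  assumes "finite B" "A \<subseteq> B" "A' \<subseteq> B" "card A = card A'"
  obtains \<tau> where "\<tau> permutes B" "\<tau> ` A = A'"
proof -
  obtain f where f: "bij_betw f A A'"
    using assms by (meson finite_same_card_bij finite_subset)
  obtain \<tau> where \<tau>: "\<tau> permutes B" "\<And>x. x \<in> A \<Longrightarrow> \<tau> x = f x"
    using permutes_extend_inj_on[of B A f] assms f by (auto simp: bij_betw_def)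
  have "\<tau> ` A = A'"
    using f \<tau>(2) by (auto simp: bij_betw_def)
  with \<tau>(1) show ?thesis by (rule that)
qed

text \<open>Given that \<open>J\<close> is sent to \<open>B\<close>, the image of \<open>I\<close>
  is uniform among the subsets of \<open>B\<close> of its size: permutations of \<open>B\<close>
  preserve the condition and carry any such subset to any other.\<close>

lemma perm_prob_nested:
  assumes "I \<subseteq> J" "J \<subseteq> {1..n}" "A \<subseteq> B" "B \<subseteq> {1..n}" "card A = card I" "card B = card J"
  shows "perm_prob n (\<lambda>\<sigma>. \<sigma> ` J = B \<and> \<sigma> ` I = A) =
    perm_prob n (\<lambda>\<sigma>. \<sigma> ` J = B) / real (card J choose card I)"
proof -
  define c where "c A' = perm_prob n (\<lambda>\<sigma>. \<sigma> ` J = B \<and> \<sigma> ` I = A')" for A'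
  define S where "S = {A'. A' \<subseteq> B \<and> card A' = card I}"
  have finB: "finite B" using assms(4) finite_subset by blast
  have finS: "finite S" unfolding S_def using finB by simp
  have cardS: "card S = card J choose card I"
    unfolding S_def using n_subsets[OF finB, of "card I"] assms(6) by simp
  have eq: "c A' = c A" if A': "A' \<in> S" for A'
  proof -
    obtain \<tau> where \<tau>: "\<tau> permutes B" "\<tau> ` A = A'"
      using permutes_mapping_subset[OF finB assms(3), of A'] A' assms(5) unfolding S_def by auto
    have \<tau>n: "\<tau> permutes {1..n}" using \<tau>(1) assms(4) by (rule permutes_subset)
    have inj: "inj \<tau>" using \<tau>(1) by (rule permutes_inj)
    have *: "(\<tau> \<circ> \<sigma>) ` J = B \<longleftrightarrow> \<sigma> ` J = B" "(\<tau> \<circ> \<sigma>) ` I = A' \<longleftrightarrow> \<sigma> ` I = A" for \<sigma>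
      using inj_image_eq_iff[OF inj] permutes_image[OF \<tau>(1)] \<tau>(2) by (metis image_comp)+
    have "c A' = perm_prob n (\<lambda>\<sigma>. (\<tau> \<circ> \<sigma>) ` J = B \<and> (\<tau> \<circ> \<sigma>) ` I = A')"
      unfolding c_def
      by (rule perm_avg_compose_left[OF \<tau>n, of "\<lambda>\<sigma>. of_bool (\<sigma> ` J = B \<and> \<sigma> ` I = A')", symmetric])
    then show ?thesis by (simp only: * c_def)
  qed
  have one: "(\<Sum>A'\<in>S. of_bool (\<sigma> ` J = B \<and> \<sigma> ` I = A')) = (of_bool (\<sigma> ` J = B) :: real)"
    if "\<sigma> permutes {1..n}" for \<sigma>
  proof (cases "\<sigma> ` J = B")
    case True
    have "\<sigma> ` I \<in> S"
      unfolding S_def using True assms(1) permutes_inj_on[OF that] by (auto simp: card_image)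
    then show ?thesis
      using True finS by (simp add: of_bool_def)
  qed simp
  have "(\<Sum>A'\<in>S. c A') = perm_avg n (\<lambda>\<sigma>. \<Sum>A'\<in>S. of_bool (\<sigma> ` J = B \<and> \<sigma> ` I = A'))"
    by (simp add: c_def perm_avg_sum)
  also have "\<dots> = perm_prob n (\<lambda>\<sigma>. \<sigma> ` J = B)"
    using one by (intro perm_avg_cong) auto
  finally have "real (card J choose card I) * c A = perm_prob n (\<lambda>\<sigma>. \<sigma> ` J = B)"
    using eq cardS by simp
  moreover have "card I \<le> card J"
    using assms(1,2) by (meson card_mono finite_atLeastAtMost finite_subset)
  ultimately show ?thesis
    unfolding c_def by (simp add: field_simps)
qed

lemma perm_prob_image_eq:
  assumes "I \<subseteq> {1..n}" "A \<subseteq> {1..n}" "card A = card I"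
  shows "perm_prob n (\<lambda>\<sigma>. \<sigma> ` I = A) = 1 / real (n choose card I)"
proof -
  have "perm_prob n (\<lambda>\<sigma>. \<sigma> ` I = A) = perm_prob n (\<lambda>\<sigma>. \<sigma> ` {1..n} = {1..n} \<and> \<sigma> ` I = A)"
    by (intro perm_avg_cong) (use permutes_image in auto)
  also have "\<dots> = perm_prob n (\<lambda>\<sigma>. \<sigma> ` {1..n} = {1..n}) / real (n choose card I)"
    using perm_prob_nested[of I "{1..n}" n A "{1..n}"] assms by simp
  also have "perm_prob n (\<lambda>\<sigma>. \<sigma> ` {1..n} = {1..n}) = perm_avg n (\<lambda>\<sigma>. 1)"
  proof (rule perm_avg_cong)
    fix \<sigma> assume "\<sigma> permutes {1..n}"
    then have "\<sigma> ` {1..n} = {1..n}" by (rule permutes_image)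
    then show "of_bool (\<sigma> ` {1..n} = {1..n}) = (1::real)" by simp
  qed
  finally show ?thesis by (simp add: perm_avg_const)
qed

text \<open>Linearity of expectation: \<open>B\<close> can be hit only by the position set of size
  \<open>card B\<close>, with probability \<open>1 / (n choose card B)\<close>. One position set per
  size is enough; later uses take prefixes and complements of prefixes.\<close>

lemma lubell_eq_expected_hits:
  assumes "F \<subseteq> Pow {1..n}" "\<And>i. i \<in> K \<Longrightarrow> I i \<subseteq> {1..n} \<and> card (I i) = i"
    "finite K" "\<And>B. B \<in> F \<Longrightarrow> card B \<in> K"
  shows "lubell n F = perm_avg n (\<lambda>\<sigma>. \<Sum>i\<in>K. of_bool (\<sigma> ` I i \<in> F))"
proof -
  have finF: "finite F" using assms(1) finite_subset by blast
  have "perm_avg n (\<lambda>\<sigma>. \<Sum>i\<in>K. of_bool (\<sigma> ` I i \<in> F)) =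
      perm_avg n (\<lambda>\<sigma>. \<Sum>B\<in>F. of_bool (\<sigma> ` I (card B) = B))"
  proof (rule perm_avg_cong)
    fix \<sigma> assume s: "\<sigma> permutes {1..n}"
    have c: "card (\<sigma> ` I i) = i" if "i \<in> K" for i
      using assms(2)[OF that] permutes_inj_on[OF s] by (simp add: card_image)
    have "bij_betw (\<lambda>i. \<sigma> ` I i) {i\<in>K. \<sigma> ` I i \<in> F} {B\<in>F. \<sigma> ` I (card B) = B}"
      by (rule bij_betw_byWitness[where f' = card]) (use c assms(4) in auto)
    then have "card {i\<in>K. \<sigma> ` I i \<in> F} = card {B\<in>F. \<sigma> ` I (card B) = B}"
      by (rule bij_betw_same_card)
    then show "(\<Sum>i\<in>K. of_bool (\<sigma> ` I i \<in> F)) = (\<Sum>B\<in>F. of_bool (\<sigma> ` I (card B) = B) :: real)"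
      using finF assms(3) by (simp add: sum.If_cases of_bool_def Int_def)
  qed
  also have "\<dots> = (\<Sum>B\<in>F. perm_prob n (\<lambda>\<sigma>. \<sigma> ` I (card B) = B))"
    by (simp add: perm_avg_sum)
  also have "\<dots> = lubell n F"
    unfolding lubell_def
  proof (rule sum.cong)
    fix B assume "B \<in> F"
    then show "perm_prob n (\<lambda>\<sigma>. \<sigma> ` I (card B) = B) = 1 / real (n choose card B)"
      using perm_prob_image_eq[of "I (card B)" n B] assms by auto
  qed simp
  finally show ?thesis by simp
qed

text \<open>Once \<open>B\<close> is hit, a given \<open>A \<subset> B\<close> is hit with
  probability \<open>1 / (card B choose card A)\<close>. This is at most \<open>1 / m\<close>,
  because \<open>0 < card A < card B\<close> and \<open>m \<le> card B\<close>. At most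
  \<open>r\<close> sets \<open>A\<close> compete for each \<open>B\<close>. Separate maps
  \<open>I\<close> and \<open>J\<close> allow prefixes to be paired with exchanged prefixes.\<close>

lemma expected_nested_pairs_le:
  assumes L: "L \<subseteq> Pow {1..n}" and G: "G \<subseteq> Pow {1..n}" and m: "m > 0"
    and sizes: "\<And>B. B \<in> L \<Longrightarrow> m \<le> card B" "\<And>A. A \<in> G \<Longrightarrow> 0 < card A"
    and few: "\<And>B. B \<in> L \<Longrightarrow> card {A \<in> G. A \<subset> B} \<le> r"
    and Q: "finite Q" "\<And>i k. (i, k) \<in> Q \<Longrightarrow> i < k \<and> I i \<subseteq> J k \<and> J k \<subseteq> {1..n} \<and> card (I i) = i \<and> card (J k) = k"
  shows "perm_avg n (\<lambda>\<sigma>. \<Sum>(i, k)\<in>Q. of_bool (\<sigma> ` I i \<in> G \<and> \<sigma> ` J k \<in> L))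
    \<le> real r / real m * lubell n L"
proof -
  have finL: "finite L" and finG: "finite G" using L G finite_subset by blast+
  define Z where "Z = Sigma L (\<lambda>B. {A \<in> G. A \<subset> B})"
  define R :: "(nat \<Rightarrow> nat) \<Rightarrow> nat set \<times> nat set \<Rightarrow> bool" where "R \<sigma> = (\<lambda>(B, A). (card A, card B) \<in> Q \<and> \<sigma> ` J (card B) = B \<and> \<sigma> ` I (card A) = A)" for \<sigma>
  have finZ: "finite Z" unfolding Z_def using finL finG by auto
  have "perm_avg n (\<lambda>\<sigma>. \<Sum>(i, k)\<in>Q. of_bool (\<sigma> ` I i \<in> G \<and> \<sigma> ` J k \<in> L))
      \<le> perm_avg n (\<lambda>\<sigma>. \<Sum>z\<in>Z. of_bool (R \<sigma> z))"
  proof (rule perm_avg_mono)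
    fix \<sigma> assume s: "\<sigma> permutes {1..n}"
    have c: "card (\<sigma> ` X) = card X" for X
      using permutes_inj_on[OF s] by (simp add: card_image)
    \<comment> \<open>Permutations preserve cardinality, so the two hit sets determine the index
      pair \<open>(i, k)\<close>.\<close>
    have "card {(i, k). (i, k) \<in> Q \<and> \<sigma> ` I i \<in> G \<and> \<sigma> ` J k \<in> L} \<le> card {z\<in>Z. R \<sigma> z}"
    proof (rule card_inj_on_le)
      show "inj_on (\<lambda>(i, k). (\<sigma> ` J k, \<sigma> ` I i)) {(i, k). (i, k) \<in> Q \<and> \<sigma> ` I i \<in> G \<and> \<sigma> ` J k \<in> L}"
      proof (rule inj_onI, clarify)
        fix i k i' k'
        assume "(i, k) \<in> Q" "(i', k') \<in> Q" "\<sigma> ` J k = \<sigma> ` J k'" "\<sigma> ` I i = \<sigma> ` I i'"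
        then show "i = i' \<and> k = k'" using c Q(2) by metis
      qed
      show "(\<lambda>(i, k). (\<sigma> ` J k, \<sigma> ` I i)) ` {(i, k). (i, k) \<in> Q \<and> \<sigma> ` I i \<in> G \<and> \<sigma> ` J k \<in> L}
          \<subseteq> {z\<in>Z. R \<sigma> z}"
      proof (clarify)
        fix i k assume ik: "(i, k) \<in> Q" "\<sigma> ` I i \<in> G" "\<sigma> ` J k \<in> L"
        note q = Q(2)[OF ik(1)]
        have "\<sigma> ` I i \<subseteq> \<sigma> ` J k" using q by auto
        moreover have "\<sigma> ` I i \<noteq> \<sigma> ` J k" using q c by (metis less_irrefl)
        ultimately have "\<sigma> ` I i \<subset> \<sigma> ` J k" by blast
        then show "(\<sigma> ` J k, \<sigma> ` I i) \<in> Z \<and> R \<sigma> (\<sigma> ` J k, \<sigma> ` I i)"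
          using ik q c by (auto simp: Z_def R_def)
      qed
      show "finite {z\<in>Z. R \<sigma> z}" using finZ by simp
    qed
    moreover have "(\<Sum>(i, k)\<in>Q. of_bool (\<sigma> ` I i \<in> G \<and> \<sigma> ` J k \<in> L) :: real)
        = card {(i, k). (i, k) \<in> Q \<and> \<sigma> ` I i \<in> G \<and> \<sigma> ` J k \<in> L}"
    proof -
      have "(\<Sum>(i, k)\<in>Q. of_bool (\<sigma> ` I i \<in> G \<and> \<sigma> ` J k \<in> L) :: real)
        = (\<Sum>z\<in>Q. of_bool (\<sigma> ` I (fst z) \<in> G \<and> \<sigma> ` J (snd z) \<in> L))"
        by (simp add: case_prod_beta)
      also have "\<dots> = card {z\<in>Q. \<sigma> ` I (fst z) \<in> G \<and> \<sigma> ` J (snd z) \<in> L}"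
        using Q(1) by (simp add: of_bool_def sum.If_cases Int_def)
      also have "{z\<in>Q. \<sigma> ` I (fst z) \<in> G \<and> \<sigma> ` J (snd z) \<in> L} = {(i, k). (i, k) \<in> Q \<and> \<sigma> ` I i \<in> G \<and> \<sigma> ` J k \<in> L}"
        by auto
      finally show ?thesis .
    qed
    moreover have "(\<Sum>z\<in>Z. of_bool (R \<sigma> z) :: real) = card {z\<in>Z. R \<sigma> z}"
      using finZ by (simp add: of_bool_def sum.If_cases Int_def)
    ultimately show "(\<Sum>(i, k)\<in>Q. of_bool (\<sigma> ` I i \<in> G \<and> \<sigma> ` J k \<in> L)) \<le> (\<Sum>z\<in>Z. of_bool (R \<sigma> z) :: real)"
      by simp
  qed
  also have "\<dots> = (\<Sum>(B, A)\<in>Z. perm_prob n (\<lambda>\<sigma>. R \<sigma> (B, A)))"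
    by (simp add: perm_avg_sum case_prod_beta)
  also have "\<dots> \<le> (\<Sum>(B, A)\<in>Z. 1 / real (n choose card B) * (1 / real m))"
  proof (intro sum_mono, clarify)
    fix B A assume "(B, A) \<in> Z"
    then have z: "B \<in> L" "A \<in> G" "A \<subset> B" by (auto simp: Z_def)
    show "perm_prob n (\<lambda>\<sigma>. R \<sigma> (B, A)) \<le> 1 / real (n choose card B) * (1 / real m)"
    proof (cases "(card A, card B) \<in> Q")
      case False
      then show ?thesis by (simp add: R_def perm_avg_const)
    next
      case True
      note q = Q(2)[OF True]
      have "m \<le> card B" using sizes z by auto
      also have "card B \<le> card B choose card A"
      proof -
        have "0 < card A" "card A < card B" using sizes z q by auto
        then show ?thesis using upper_le_binomial by simp
      qed
      finally have "m \<le> card B choose card A" .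
      then have "1 / real (card B choose card A) \<le> 1 / real m"
        using m by (simp add: frac_le)
      then have "1 / real (n choose card B) * (1 / real (card B choose card A)) \<le> 1 / real (n choose card B) * (1 / real m)"
        by (rule mult_left_mono) simp
      moreover have "perm_prob n (\<lambda>\<sigma>. R \<sigma> (B, A)) = 1 / real (n choose card B) * (1 / real (card B choose card A))"
      proof -
        have "perm_prob n (\<lambda>\<sigma>. R \<sigma> (B, A)) = perm_prob n (\<lambda>\<sigma>. \<sigma> ` J (card B) = B \<and> \<sigma> ` I (card A) = A)"
          using True by (simp add: R_def)
        also have "\<dots> = perm_prob n (\<lambda>\<sigma>. \<sigma> ` J (card B) = B) / real (card (J (card B)) choose card (I (card A)))"
          by (rule perm_prob_nested) (use q z L in auto)
        also have "perm_prob n (\<lambda>\<sigma>. \<sigma> ` J (card B) = B) = 1 / real (n choose card (J (card B)))"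
          by (rule perm_prob_image_eq) (use q z L in auto)
        finally show ?thesis using q by simp
      qed
      ultimately show ?thesis by simp
    qed
  qed
  also have "\<dots> = (\<Sum>B\<in>L. real (card {A \<in> G. A \<subset> B}) * (1 / real (n choose card B) * (1 / real m)))"
    unfolding Z_def using finL finG by (subst sum.Sigma[symmetric]) auto
  also have "\<dots> \<le> (\<Sum>B\<in>L. real r * (1 / real (n choose card B) * (1 / real m)))"
    using few by (intro sum_mono mult_right_mono) auto
  also have "\<dots> = real r / real m * lubell n L"
    by (simp add: lubell_def sum_distrib_left mult.commute)
  finally show ?thesis .
qed

subsection \<open>Families with few nested members\<close>

text \<open>The size bounds are symmetric so that they survive complementation, by which families
  with few members above each member are reduced to this notion.\<close>

definition thin_family :: "nat \<Rightarrow> nat \<Rightarrow> nat \<Rightarrow> nat set set \<Rightarrow> bool" where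
  "thin_family n m r L \<longleftrightarrow> L \<subseteq> Pow {1..n} \<and> (\<forall>B\<in>L. m \<le> card B \<and> card B + m \<le> n) \<and>
     (\<forall>B\<in>L. card {A \<in> L. A \<subset> B} \<le> r)"

lemma card_le_sum_real:
  fixes f :: "'b \<Rightarrow> real"
  assumes "finite Q" "inj_on g X" "\<And>q. f q \<ge> 0" "\<And>x. x \<in> X \<Longrightarrow> g x \<in> Q \<and> f (g x) \<ge> 1"
  shows "real (card X) \<le> sum f Q"
proof -
  have "real (card X) = (\<Sum>q\<in>g ` X. 1)"
    using assms(2) by (simp add: card_image)
  also have "\<dots> \<le> sum f (g ` X)"
    using assms(4) by (intro sum_mono) auto
  also have "\<dots> \<le> sum f Q"
    using assms by (intro sum_mono2) auto
  finally show ?thesis .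
qed

text \<open>Let \<open>M\<close> be the largest index satisfying \<open>R\<close>. At most
  \<open>c\<close> such indices exceed \<open>M - c\<close>, and each of the others forms a
  separated pair with \<open>M\<close>. Prefixes need \<open>c = 1\<close>. Exchanged prefixes need
  \<open>c = 2\<close>, as consecutive ones are not nested.\<close>

lemma card_le_sum_separated_pairs:
  fixes K :: "nat set"
  assumes "finite K"
  shows "(\<Sum>i\<in>K. of_bool (R i) :: real) \<le>
    real c + (\<Sum>(i, k)\<in>Sigma K (\<lambda>i. {k\<in>K. i + c \<le> k}). of_bool (R i \<and> R k))"
proof -
  define H where "H = {i\<in>K. R i}"
  have finH: "finite H" using assms by (simp add: H_def)
  have sum: "(\<Sum>i\<in>K. of_bool (R i) :: real) = card H"
    using assms by (simp add: H_def of_bool_def sum.If_cases Int_def)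
  show ?thesis
  proof (cases "H = {}")
    case True
    then show ?thesis using sum by (simp add: sum_nonneg case_prod_beta)
  next
    case False
    define M where "M = Max H"
    have M: "M \<in> H" "\<And>i. i \<in> H \<Longrightarrow> i \<le> M"
      using finH False by (auto simp: M_def)
    have "H \<subseteq> {i\<in>H. i + c \<le> M} \<union> {M + 1 - c..M}" using M by auto
    then have "card H \<le> card ({i\<in>H. i + c \<le> M} \<union> {M + 1 - c..M})"
      using finH by (intro card_mono) auto
    also have "\<dots> \<le> card {i\<in>H. i + c \<le> M} + card {M + 1 - c..M}"
      by (rule card_Un_le)
    also have "card {M + 1 - c..M} \<le> c" by simp
    finally have "real (card H) \<le> real c + real (card {i\<in>H. i + c \<le> M})" by simp
    also have "real (card {i\<in>H. i + c \<le> M}) \<le>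
        (\<Sum>(i, k)\<in>Sigma K (\<lambda>i. {k\<in>K. i + c \<le> k}). of_bool (R i \<and> R k))"
      by (rule card_le_sum_real[where g = "\<lambda>i. (i, M)"])
        (use assms M in \<open>auto simp: H_def inj_on_def\<close>)
    finally show ?thesis using sum by simp
  qed
qed

text \<open>The condition \<open>2 * r \<le> m\<close> keeps \<open>r / m\<close> at most one half,
  so that a bound on the Lubell mass in terms of itself can be solved.\<close>

locale thin =
  fixes n m r :: nat and L :: "nat set set"
  assumes thin: "thin_family n m r L" and m: "m > 0" "2 * r \<le> m"
begin

lemma L_subset: "L \<subseteq> Pow {1..n}"
  using thin by (simp add: thin_family_def)

lemma card_bounds: "B \<in> L \<Longrightarrow> m \<le> card B \<and> card B + m \<le> n"
  using thin by (simp add: thin_family_def)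

lemma expected_hits:
  assumes "\<And>i. i \<in> {1..<n} \<Longrightarrow> I i \<subseteq> {1..n} \<and> card (I i) = i"
  shows "lubell n L = perm_avg n (\<lambda>\<sigma>. \<Sum>i\<in>{1..<n}. of_bool (\<sigma> ` I i \<in> L))"
proof (rule lubell_eq_expected_hits[OF L_subset])
  fix B assume "B \<in> L"
  then show "card B \<in> {1..<n}" using card_bounds[of B] m by auto
qed (use assms in auto)

lemma lubell_nonneg: "lubell n L \<ge> 0"
  by (simp add: lubell_def sum_nonneg)

lemma expected_pairs_le_lubell:
  assumes "finite Q" "\<And>i k. (i, k) \<in> Q \<Longrightarrow> i < k \<and> I i \<subseteq> J k \<and> J k \<subseteq> {1..n} \<and> card (I i) = i \<and> card (J k) = k"
  shows "perm_avg n (\<lambda>\<sigma>. \<Sum>(i, k)\<in>Q. of_bool (\<sigma> ` I i \<in> L \<and> \<sigma> ` J k \<in> L)) \<le> real r / real m * lubell n L"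
proof (rule expected_nested_pairs_le[OF L_subset L_subset m(1) _ _ _ assms])
  show "0 < card A" if "A \<in> L" for A using card_bounds[OF that] m by simp
  show "card {A \<in> L. A \<subset> B} \<le> r" if "B \<in> L" for B
    using thin that by (simp add: thin_family_def)
qed (use card_bounds in auto)

text \<open>A chain has at most one hit plus its number of hit pairs, and the expected number of
  pairs is at most \<open>r / m\<close> times the Lubell mass itself. Solving gives the bound 2, and
  inserting that bound once more gives \<open>1 + 2 * r / m\<close>.\<close>

lemma lubell_le: "lubell n L \<le> 1 + 2 * r / m" "lubell n L \<le> 2"
proof -
  define Q where "Q = Sigma {1..<n} (\<lambda>i. {k\<in>{1..<n}. i + 1 \<le> k})"
  have "lubell n L = perm_avg n (\<lambda>\<sigma>. \<Sum>i\<in>{1..<n}. of_bool (\<sigma> ` {1..i} \<in> L))"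
    by (rule expected_hits) auto
  also have "\<dots> \<le> perm_avg n (\<lambda>\<sigma>. 1 + (\<Sum>(i, k)\<in>Q. of_bool (\<sigma> ` {1..i} \<in> L \<and> \<sigma> ` {1..k} \<in> L)))"
    unfolding Q_def
    by (rule perm_avg_mono, rule card_le_sum_separated_pairs[of "{1..<n}" _ 1, unfolded of_nat_1]) simp
  also have "\<dots> = 1 + perm_avg n (\<lambda>\<sigma>. \<Sum>(i, k)\<in>Q. of_bool (\<sigma> ` {1..i} \<in> L \<and> \<sigma> ` {1..k} \<in> L))"
    by (simp add: perm_avg_add perm_avg_const)
  also have "\<dots> \<le> 1 + real r / real m * lubell n L"
    by (intro add_left_mono expected_pairs_le_lubell) (auto simp: Q_def)
  finally have *: "lubell n L \<le> 1 + real r / real m * lubell n L" .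
  have "real r / real m \<le> 1 / 2" using m by (simp add: field_simps)
  then have "real r / real m * lubell n L \<le> 1 / 2 * lubell n L"
    using lubell_nonneg by (rule mult_right_mono)
  with * show 2: "lubell n L \<le> 2" by linarith
  have "real r / real m * lubell n L \<le> real r / real m * 2"
    using 2 by (rule mult_left_mono) simp
  with * show "lubell n L \<le> 1 + 2 * r / m" by (simp add: mult.commute)
qed

lemma expected_pairs_le:
  assumes "finite Q" "\<And>i k. (i, k) \<in> Q \<Longrightarrow> i < k \<and> I i \<subseteq> J k \<and> J k \<subseteq> {1..n} \<and> card (I i) = i \<and> card (J k) = k"
  shows "perm_avg n (\<lambda>\<sigma>. \<Sum>(i, k)\<in>Q. of_bool (\<sigma> ` I i \<in> L \<and> \<sigma> ` J k \<in> L)) \<le> 2 * r / m"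
proof -
  have "real r / real m * lubell n L \<le> real r / real m * 2"
    using lubell_le(2) by (rule mult_left_mono) simp
  then show ?thesis
    using expected_pairs_le_lubell[OF assms] by (simp add: mult.commute)
qed

text \<open>Hits beyond the first are paid for by nested pairs, so the probability of any hit is
  almost the expected number of hits.\<close>

lemma hit_prob_ge:
  assumes I: "\<And>i. i \<in> {1..<n} \<Longrightarrow> I i \<subseteq> {1..n} \<and> card (I i) = i" "\<And>i k. i \<le> k \<Longrightarrow> I i \<subseteq> I k"
  shows "perm_prob n (\<lambda>\<sigma>. \<exists>i\<in>{1..<n}. \<sigma> ` I i \<in> L) \<ge> lubell n L - 2 * r / m"
proof -
  define Q where "Q = Sigma {1..<n} (\<lambda>i. {k\<in>{1..<n}. i + 1 \<le> k})"
  have "lubell n L = perm_avg n (\<lambda>\<sigma>. \<Sum>i\<in>{1..<n}. of_bool (\<sigma> ` I i \<in> L))"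
    by (rule expected_hits) (use I(1) in auto)
  also have "\<dots> \<le> perm_avg n (\<lambda>\<sigma>. of_bool (\<exists>i\<in>{1..<n}. \<sigma> ` I i \<in> L) +
      (\<Sum>(i, k)\<in>Q. of_bool (\<sigma> ` I i \<in> L \<and> \<sigma> ` I k \<in> L)))"
  proof (rule perm_avg_mono)
    fix \<sigma>
    show "(\<Sum>i\<in>{1..<n}. of_bool (\<sigma> ` I i \<in> L)) \<le> of_bool (\<exists>i\<in>{1..<n}. \<sigma> ` I i \<in> L) +
      (\<Sum>(i, k)\<in>Q. of_bool (\<sigma> ` I i \<in> L \<and> \<sigma> ` I k \<in> L) :: real)"
    proof (cases "\<exists>i\<in>{1..<n}. \<sigma> ` I i \<in> L")
      case True
      then show ?thesis
        using card_le_sum_separated_pairs[of "{1..<n}" "\<lambda>i. \<sigma> ` I i \<in> L" 1] by (simp add: Q_def)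
    next
      case False
      then have "(\<Sum>i\<in>{1..<n}. of_bool (\<sigma> ` I i \<in> L)) = (0::real)"
        by (intro sum.neutral) auto
      then show ?thesis by (simp add: sum_nonneg case_prod_beta)
    qed
  qed
  also have "\<dots> = perm_prob n (\<lambda>\<sigma>. \<exists>i\<in>{1..<n}. \<sigma> ` I i \<in> L) +
      perm_avg n (\<lambda>\<sigma>. \<Sum>(i, k)\<in>Q. of_bool (\<sigma> ` I i \<in> L \<and> \<sigma> ` I k \<in> L))"
    by (simp add: perm_avg_add)
  also have "perm_avg n (\<lambda>\<sigma>. \<Sum>(i, k)\<in>Q. of_bool (\<sigma> ` I i \<in> L \<and> \<sigma> ` I k \<in> L)) \<le> 2 * r / m"
    by (rule expected_pairs_le) (use I in \<open>auto simp: Q_def\<close>)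
  finally show ?thesis by simp
qed

end

section \<open>Exchanging two consecutive steps of a chain\<close>

definition exchange_prob :: "nat \<Rightarrow> nat set set \<Rightarrow> nat \<Rightarrow> real" where
  "exchange_prob n L i = perm_prob n (\<lambda>\<sigma>. \<sigma> ` insert (Suc i) {1..<i} \<in> L \<and> \<sigma> ` {1..i} \<notin> L)"

text \<open>The sets in \<open>exchange_prob\<close> are the \<open>i\<close>-th prefixes after and
  before transposing positions \<open>i\<close> and \<open>Suc i\<close>. Any two
  \<open>i\<close>-sets sharing \<open>i - 1\<close> positions arise from these by one permutation
  of the positions. Their union has \<open>Suc i\<close> elements, hence
  \<open>i < n\<close>.\<close>

lemma perm_prob_exchange:
  assumes "I \<subseteq> {1..n}" "I' \<subseteq> {1..n}" "card I = i" "card I' = i" "Suc (card (I \<inter> I')) = i"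
  shows "perm_prob n (\<lambda>\<sigma>. \<sigma> ` I \<in> L \<and> \<sigma> ` I' \<notin> L) = exchange_prob n L i" and "i \<in> {1..<n}"
proof -
  have fin: "finite I" "finite I'" using assms(1,2) finite_subset by blast+
  have "card (I - I') = 1" "card (I' - I) = 1"
    using assms fin card_Diff_subset_Int[of I I'] card_Diff_subset_Int[of I' I]
    by (auto simp: Int_commute)
  then obtain x y where xy: "I - I' = {x}" "I' - I = {y}"
    by (meson card_1_singletonE)
  define K where "K = I \<inter> I'"
  have IK: "I = insert x K" "I' = insert y K" "x \<notin> K" "y \<notin> K" "x \<noteq> y"
    using xy by (auto simp: K_def)
  have finK: "finite K" using fin by (simp add: K_def)
  have cK: "card K = i - 1" "i \<ge> 1" using assms(5) by (auto simp: K_def)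
  have "card (insert x (insert y K)) \<le> card {1..n}"
    by (rule card_mono) (use assms(1,2) IK in auto)
  then have "Suc i \<le> n" using IK cK finK by simp
  then show i: "i \<in> {1..<n}" using cK by simp
  have "card {1..<i} = card K" using cK by simp
  then obtain g where g: "bij_betw g {1..<i} K"
    using finK by (meson finite_same_card_bij finite_atLeastLessThan)
  define f where "f = g(i := y, Suc i := x)"
  have gf: "f ` {1..<i} = K" "inj_on f {1..<i}" "f i = y" "f (Suc i) = x"
    using g by (auto simp: f_def bij_betw_def inj_on_def)
  have dec: "{1..Suc i} = insert (Suc i) (insert i {1..<i})" using i by auto
  have inj: "inj_on f {1..Suc i}"
    unfolding dec using gf IK by auto
  have "f ` {1..Suc i} \<subseteq> {1..n}"
    unfolding dec using gf IK assms(1,2) by auto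
  then obtain \<tau> where \<tau>: "\<tau> permutes {1..n}" "\<And>j. j \<in> {1..Suc i} \<Longrightarrow> \<tau> j = f j"
    using permutes_extend_inj_on[of "{1..n}" "{1..Suc i}" f] inj i by auto
  have \<tau>I: "\<tau> ` insert (Suc i) {1..<i} = I"
  proof -
    have "\<tau> ` insert (Suc i) {1..<i} = f ` insert (Suc i) {1..<i}"
      by (rule image_cong) (use \<tau>(2) in auto)
    then show ?thesis using gf IK by simp
  qed
  have \<tau>I': "\<tau> ` {1..i} = I'"
  proof -
    have "\<tau> ` {1..i} = f ` {1..i}"
      by (rule image_cong) (use \<tau>(2) in auto)
    also have "\<dots> = f ` insert i {1..<i}"
      using i by (intro arg_cong[where f = "image f"]) auto
    finally show ?thesis using gf IK by simp
  qed
  have "exchange_prob n L i =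
      perm_prob n (\<lambda>\<sigma>. (\<sigma> \<circ> \<tau>) ` insert (Suc i) {1..<i} \<in> L \<and> (\<sigma> \<circ> \<tau>) ` {1..i} \<notin> L)"
    unfolding exchange_prob_def
    by (rule perm_avg_compose_right[OF \<tau>(1), symmetric])
  then show "perm_prob n (\<lambda>\<sigma>. \<sigma> ` I \<in> L \<and> \<sigma> ` I' \<notin> L) = exchange_prob n L i"
    by (simp only: image_comp[symmetric] \<tau>I \<tau>I')
qed

context thin
begin

text \<open>If the chain misses \<open>L\<close>, at most two exchanged prefixes lie in
  \<open>L\<close>, apart from nested pairs. If it hits \<open>L\<close> at \<open>k\<close>, the
  exchanged prefix \<open>s i\<close> is contained in \<open>{1..k}\<close> for \<open>i < k\<close>
  and contains it for \<open>k < i\<close>, so every exchange into \<open>L\<close> yields a nested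
  pair.\<close>

lemma sum_exchange_prob_le:
  "(\<Sum>i\<in>{1..<n}. exchange_prob n L i) \<le> 2 * (1 - lubell n L) + 10 * r / m"
proof -
  define K where "K = {1..<n}"
  define Q1 where "Q1 = Sigma K (\<lambda>i. {k\<in>K. i + 2 \<le> k})"
  define Q2 where "Q2 = Sigma K (\<lambda>i. {k\<in>K. i < k})"
  define s where "s i = insert (Suc i) {1..<i}" for i :: nat
  define hit where "hit \<sigma> \<longleftrightarrow> (\<exists>i\<in>K. \<sigma> ` {1..i} \<in> L)" for \<sigma>
  define X1 where "X1 \<sigma> = (\<Sum>(i, k)\<in>Q1. of_bool (\<sigma> ` s i \<in> L \<and> \<sigma> ` s k \<in> L) :: real)" for \<sigma>
  define X2 where "X2 \<sigma> = (\<Sum>(i, k)\<in>Q2. of_bool (\<sigma> ` s i \<in> L \<and> \<sigma> ` {1..k} \<in> L) :: real)" for \<sigma>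
  define X3 where "X3 \<sigma> = (\<Sum>(k, i)\<in>Q2. of_bool (\<sigma> ` {1..k} \<in> L \<and> \<sigma> ` s i \<in> L) :: real)" for \<sigma>
  have finQ: "finite K" "finite Q1" "finite Q2" by (auto simp: K_def Q1_def Q2_def)
  have nonneg: "X1 \<sigma> \<ge> 0" "X2 \<sigma> \<ge> 0" "X3 \<sigma> \<ge> 0" for \<sigma>
    by (auto simp: X1_def X2_def X3_def intro!: sum_nonneg)
  have "(\<Sum>i\<in>K. exchange_prob n L i) =
      perm_avg n (\<lambda>\<sigma>. \<Sum>i\<in>K. of_bool (\<sigma> ` s i \<in> L \<and> \<sigma> ` {1..i} \<notin> L))"
    by (simp add: exchange_prob_def perm_avg_sum s_def)
  also have "\<dots> \<le> perm_avg n (\<lambda>\<sigma>. (2 * (1 - of_bool (hit \<sigma>)) + X1 \<sigma>) + (X2 \<sigma> + X3 \<sigma>))"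
  proof (rule perm_avg_mono)
    fix \<sigma>
    show "(\<Sum>i\<in>K. of_bool (\<sigma> ` s i \<in> L \<and> \<sigma> ` {1..i} \<notin> L)) \<le>
        (2 * (1 - of_bool (hit \<sigma>)) + X1 \<sigma>) + (X2 \<sigma> + X3 \<sigma>)"
    proof (cases "hit \<sigma>")
      case False
      have "(\<Sum>i\<in>K. of_bool (\<sigma> ` s i \<in> L \<and> \<sigma> ` {1..i} \<notin> L) :: real) \<le> (\<Sum>i\<in>K. of_bool (\<sigma> ` s i \<in> L))"
        by (intro sum_mono) auto
      also have "\<dots> \<le> 2 + X1 \<sigma>"
        using card_le_sum_separated_pairs[OF finQ(1), of "\<lambda>i. \<sigma> ` s i \<in> L" 2] by (simp add: X1_def Q1_def)
      finally show ?thesis using nonneg[of \<sigma>] False by simp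
    next
      case True
      then obtain k where k: "k \<in> K" "\<sigma> ` {1..k} \<in> L" by (auto simp: hit_def)
      define H where "H = {i\<in>K. \<sigma> ` s i \<in> L \<and> \<sigma> ` {1..i} \<notin> L}"
      \<comment> \<open>The index \<open>k\<close> itself is excluded because \<open>H\<close>
        requires the old prefix to lie outside \<open>L\<close>.\<close>
      have "i < k \<or> k < i" if "i \<in> H" for i
        using that k by (cases "i = k") (auto simp: H_def)
      then have "H = {i\<in>H. i < k} \<union> {i\<in>H. k < i}" by blast
      then have "card H \<le> card {i\<in>H. i < k} + card {i\<in>H. k < i}"
        by (metis card_Un_le)
      moreover have "real (card {i\<in>H. i < k}) \<le> X2 \<sigma>"
        unfolding X2_def
        by (rule card_le_sum_real[where g = "\<lambda>i. (i, k)"])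
          (use finQ k in \<open>auto simp: Q2_def H_def inj_on_def\<close>)
      moreover have "real (card {i\<in>H. k < i}) \<le> X3 \<sigma>"
        unfolding X3_def
        by (rule card_le_sum_real[where g = "\<lambda>i. (k, i)"])
          (use finQ k in \<open>auto simp: Q2_def H_def inj_on_def\<close>)
      moreover have "(\<Sum>i\<in>K. of_bool (\<sigma> ` s i \<in> L \<and> \<sigma> ` {1..i} \<notin> L) :: real) = card H"
        using finQ by (simp add: H_def of_bool_def sum.If_cases Int_def)
      ultimately show ?thesis using nonneg[of \<sigma>] True by simp
    qed
  qed
  also have "\<dots> = 2 * (1 - perm_prob n hit) + perm_avg n X1 + (perm_avg n X2 + perm_avg n X3)"
    by (simp add: perm_avg_add perm_avg_cmult perm_avg_diff perm_avg_const)
  \<comment> \<open>The error 10 is 4 from twice the loss in the hit probability, plus 2 for each of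
    the three kinds of nested pairs.\<close>
  also have "\<dots> \<le> 2 * (1 - (lubell n L - 2 * r / m)) + 2 * r / m + (2 * r / m + 2 * r / m)"
  proof (intro add_mono mult_left_mono diff_mono)
    show "lubell n L - 2 * r / m \<le> perm_prob n hit"
      unfolding hit_def K_def by (rule hit_prob_ge) auto
    show "perm_avg n X1 \<le> 2 * r / m" unfolding X1_def
      by (rule expected_pairs_le) (use finQ in \<open>auto simp: Q1_def K_def s_def\<close>)
    show "perm_avg n X2 \<le> 2 * r / m" unfolding X2_def
      by (rule expected_pairs_le) (use finQ in \<open>auto simp: Q2_def K_def s_def\<close>)
    show "perm_avg n X3 \<le> 2 * r / m" unfolding X3_def
      by (rule expected_pairs_le) (use finQ in \<open>auto simp: Q2_def K_def s_def\<close>)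
  qed auto
  finally show ?thesis unfolding K_def by simp
qed

end

section \<open>Complementation and the dual bounds\<close>

definition compl_family :: "nat \<Rightarrow> nat set set \<Rightarrow> nat set set" where
  "compl_family n U = (\<lambda>B. {1..n} - B) ` U"

lemma image_mem_compl_family:
  assumes "U \<subseteq> Pow {1..n}" "\<sigma> permutes {1..n}" "I \<subseteq> {1..n}"
  shows "\<sigma> ` I \<in> compl_family n U \<longleftrightarrow> \<sigma> ` ({1..n} - I) \<in> U"
proof -
  have *: "\<sigma> ` ({1..n} - I) = {1..n} - \<sigma> ` I"
    using permutes_image[OF assms(2)] permutes_inj[OF assms(2)] by (simp add: image_set_diff)
  have "\<sigma> ` I \<subseteq> {1..n}" using permutes_image[OF assms(2)] assms(3) by blast
  then have "{1..n} - ({1..n} - \<sigma> ` I) = \<sigma> ` I" by blast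
  moreover have "{1..n} - ({1..n} - B) = B" if "B \<in> U" for B using assms(1) that by auto
  ultimately show ?thesis unfolding compl_family_def * by (auto simp: image_iff)
qed

lemma inj_on_compl: "U \<subseteq> Pow {1..n} \<Longrightarrow> inj_on (\<lambda>B. {1..n} - B) U"
  by (rule inj_on_inverseI[where g = "\<lambda>B. {1..n} - B"]) auto

lemma lubell_compl_family:
  assumes "U \<subseteq> Pow {1..n}"
  shows "lubell n (compl_family n U) = lubell n U"
proof -
  have "n choose card ({1..n} - B) = n choose card B" if "B \<in> U" for B
  proof -
    have B: "B \<subseteq> {1..n}" using assms that by auto
    then have "card B \<le> n" using card_mono[of "{1..n}" B] by simp
    then show ?thesis using B binomial_symmetric[of "card B" n] by (simp add: card_Diff_subset finite_subset)
  qed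
  then show ?thesis
    unfolding lubell_def compl_family_def using inj_on_compl[OF assms] by (simp add: sum.reindex)
qed

lemma exchange_prob_nonneg: "exchange_prob n L i \<ge> 0"
  unfolding exchange_prob_def perm_avg_def by (intro divide_nonneg_nonneg sum_nonneg) auto

text \<open>The complements of two \<open>i\<close>-sets sharing \<open>i - 1\<close> positions are
  two \<open>(n - i)\<close>-sets sharing \<open>n - i - 1\<close> positions, so they form an
  exchange at level \<open>n - i\<close>.\<close>

lemma exchange_prob_compl_family:
  assumes U: "U \<subseteq> Pow {1..n}" and i: "i \<in> {1..<n}"
  shows "exchange_prob n (compl_family n U) i = exchange_prob n U (n - i)"
proof -
  define I where "I = insert (Suc i) {1..<i}"
  define I' where "I' = {1..i}"
  have I: "I \<subseteq> {1..n}" "I' \<subseteq> {1..n}" using i by (auto simp: I_def I'_def)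
  have c: "card I = i" "card I' = i" using i by (auto simp: I_def I'_def)
  have "I \<union> I' = {1..Suc i}" using i by (auto simp: I_def I'_def)
  then have un: "card ({1..n} - (I \<union> I')) = n - Suc i" using i by (simp add: card_Diff_subset)
  have "exchange_prob n (compl_family n U) i =
      perm_prob n (\<lambda>\<sigma>. \<sigma> ` I \<in> compl_family n U \<and> \<sigma> ` I' \<notin> compl_family n U)"
    by (simp add: exchange_prob_def I_def I'_def)
  also have "\<dots> = perm_prob n (\<lambda>\<sigma>. \<sigma> ` ({1..n} - I) \<in> U \<and> \<sigma> ` ({1..n} - I') \<notin> U)"
    by (intro perm_avg_cong) (use I image_mem_compl_family[OF U] in auto)
  also have "\<dots> = exchange_prob n U (n - i)"
  proof (rule perm_prob_exchange)
    show "card ({1..n} - I) = n - i" "card ({1..n} - I') = n - i"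
      using I c by (auto simp: card_Diff_subset finite_subset)
    have "({1..n} - I) \<inter> ({1..n} - I') = {1..n} - (I \<union> I')" by auto
    then show "Suc (card (({1..n} - I) \<inter> ({1..n} - I'))) = n - i" using un i by (simp add: Suc_diff_Suc)
  qed auto
  finally show ?thesis .
qed

lemma sum_exchange_prob_compl_family:
  assumes "U \<subseteq> Pow {1..n}"
  shows "(\<Sum>i\<in>{1..<n}. exchange_prob n (compl_family n U) i) = (\<Sum>i\<in>{1..<n}. exchange_prob n U i)"
  by (rule sum.reindex_bij_witness[where i = "\<lambda>i. n - i" and j = "\<lambda>i. n - i"])
    (use exchange_prob_compl_family[OF assms] in auto)

text \<open>Complementation reverses inclusion, so this describes families whose members have few
  members above them. The results for thin families are transferred below.\<close>

locale cothin =
  fixes n m r :: nat and U :: "nat set set"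
  assumes cothin: "thin_family n m r (compl_family n U)" and U_subset: "U \<subseteq> Pow {1..n}"
    and m: "m > 0" "2 * r \<le> m"
begin

sublocale compl: thin n m r "compl_family n U"
  using cothin m by unfold_locales

lemma lubell_le: "lubell n U \<le> 1 + 2 * r / m"
  using compl.lubell_le lubell_compl_family[OF U_subset] by simp

lemma sum_exchange_prob_le:
  "(\<Sum>i\<in>{1..<n}. exchange_prob n U i) \<le> 2 * (1 - lubell n U) + 10 * r / m"
  using compl.sum_exchange_prob_le lubell_compl_family[OF U_subset] sum_exchange_prob_compl_family[OF U_subset]
  by simp

lemma card_bounds:
  assumes "B \<in> U"
  shows "m \<le> card B \<and> card B + m \<le> n"
proof -
  have B: "B \<subseteq> {1..n}" using U_subset assms by auto
  then have "card ({1..n} - B) = n - card B" "card B \<le> n"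
    using card_mono[of "{1..n}" B] by (auto simp: card_Diff_subset finite_subset)
  moreover have "{1..n} - B \<in> compl_family n U" using assms by (simp add: compl_family_def)
  ultimately show ?thesis using compl.card_bounds[of "{1..n} - B"] by auto
qed

lemma expected_pairs_le:
  assumes "finite Q" "\<And>i k. (i, k) \<in> Q \<Longrightarrow> i < k \<and> I i \<subseteq> I k \<and> I k \<subseteq> {1..n} \<and> card (I i) = i \<and> card (I k) = k"
  shows "perm_avg n (\<lambda>\<sigma>. \<Sum>(i, k)\<in>Q. of_bool (\<sigma> ` I i \<in> U \<and> \<sigma> ` I k \<in> U)) \<le> 2 * r / m"
proof -
  \<comment> \<open>Complementing a nested pair swaps its order; \<open>g\<close> records the new
    sizes and is its own inverse on the relevant range.\<close>
  define g where "g = (\<lambda>(i, k). (n - k, n - i))"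
  define J where "J j = {1..n} - I (n - j)" for j
  have le: "i \<le> n" "k \<le> n" if "(i, k) \<in> Q" for i k
    using assms(2)[OF that] card_mono[of "{1..n}" "I k"] by auto
  have inj: "inj_on g Q"
    by (rule inj_on_inverseI[where g = g]) (use le in \<open>auto simp: g_def\<close>)
  have "perm_avg n (\<lambda>\<sigma>. \<Sum>(i, k)\<in>Q. of_bool (\<sigma> ` I i \<in> U \<and> \<sigma> ` I k \<in> U)) =
      perm_avg n (\<lambda>\<sigma>. \<Sum>(i, k)\<in>g ` Q. of_bool (\<sigma> ` J i \<in> compl_family n U \<and> \<sigma> ` J k \<in> compl_family n U))"
  proof (rule perm_avg_cong)
    fix \<sigma> assume s: "\<sigma> permutes {1..n}"
    have "(\<Sum>(i, k)\<in>g ` Q. of_bool (\<sigma> ` J i \<in> compl_family n U \<and> \<sigma> ` J k \<in> compl_family n U) :: real) =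
        (\<Sum>q\<in>Q. case g q of (i, k) \<Rightarrow> of_bool (\<sigma> ` J i \<in> compl_family n U \<and> \<sigma> ` J k \<in> compl_family n U))"
      by (subst sum.reindex[OF inj]) simp
    also have "\<dots> = (\<Sum>(i, k)\<in>Q. of_bool (\<sigma> ` I i \<in> U \<and> \<sigma> ` I k \<in> U))"
    proof (rule sum.cong[OF refl], clarify)
      fix i k assume ik: "(i, k) \<in> Q"
      note q = assms(2)[OF ik]
      have "{1..n} - J (n - i) = I i" "{1..n} - J (n - k) = I k"
        using q le[OF ik] by (auto simp: J_def)
      then have "\<sigma> ` J (n - i) \<in> compl_family n U \<longleftrightarrow> \<sigma> ` I i \<in> U"
        "\<sigma> ` J (n - k) \<in> compl_family n U \<longleftrightarrow> \<sigma> ` I k \<in> U"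
        using image_mem_compl_family[OF U_subset s, of "J (n - i)"]
          image_mem_compl_family[OF U_subset s, of "J (n - k)"] by (auto simp: J_def)
      then show "(case g (i, k) of (i, k) \<Rightarrow> of_bool (\<sigma> ` J i \<in> compl_family n U \<and> \<sigma> ` J k \<in> compl_family n U)) =
          (of_bool (\<sigma> ` I i \<in> U \<and> \<sigma> ` I k \<in> U) :: real)"
        by (auto simp: g_def)
    qed
    finally show "(\<Sum>(i, k)\<in>Q. of_bool (\<sigma> ` I i \<in> U \<and> \<sigma> ` I k \<in> U)) =
        (\<Sum>(i, k)\<in>g ` Q. of_bool (\<sigma> ` J i \<in> compl_family n U \<and> \<sigma> ` J k \<in> compl_family n U) :: real)" ..
  qed
  also have "\<dots> \<le> 2 * r / m"
  proof (rule compl.expected_pairs_le)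
    show "finite (g ` Q)" using assms(1) by simp
    fix i k assume "(i, k) \<in> g ` Q"
    then obtain i' k' where ik: "(i', k') \<in> Q" "i = n - k'" "k = n - i'" by (auto simp: g_def)
    note q = assms(2)[OF ik(1)]
    have "I i' \<subseteq> {1..n}" using q by blast
    then show "i < k \<and> J i \<subseteq> J k \<and> J k \<subseteq> {1..n} \<and> card (J i) = i \<and> card (J k) = k"
      using q le[OF ik(1)] ik by (auto simp: J_def card_Diff_subset finite_subset)
  qed
  finally show ?thesis .
qed

lemma hit_prob_ge:
  "perm_prob n (\<lambda>\<sigma>. \<exists>i\<in>{1..<n}. \<sigma> ` {1..i} \<in> U) \<ge> lubell n U - 2 * r / m"
proof -
  \<comment> \<open>The last \<open>i\<close> positions: their image lies in the complement family
    exactly when the prefix of length \<open>n - i\<close> is sent into \<open>U\<close>.\<close>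
  define I where "I i = {1..n} - {1..n - i}" for i
  have "lubell n (compl_family n U) - 2 * r / m \<le>
      perm_prob n (\<lambda>\<sigma>. \<exists>i\<in>{1..<n}. \<sigma> ` I i \<in> compl_family n U)"
    by (rule compl.hit_prob_ge) (auto simp: I_def card_Diff_subset)
  also have "\<dots> = perm_prob n (\<lambda>\<sigma>. \<exists>i\<in>{1..<n}. \<sigma> ` {1..i} \<in> U)"
  proof (rule perm_avg_cong)
    fix \<sigma> assume s: "\<sigma> permutes {1..n}"
    have *: "\<sigma> ` I i \<in> compl_family n U \<longleftrightarrow> \<sigma> ` {1..n - i} \<in> U" for i
    proof -
      have "{1..n} - I i = {1..n - i}" by (auto simp: I_def)
      then show ?thesis
        using image_mem_compl_family[OF U_subset s, of "I i"] by (simp add: I_def)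
    qed
    have "(\<exists>i\<in>{1..<n}. \<sigma> ` {1..n - i} \<in> U) \<longleftrightarrow> (\<exists>i\<in>{1..<n}. \<sigma> ` {1..i} \<in> U)"
    proof
      assume "\<exists>i\<in>{1..<n}. \<sigma> ` {1..n - i} \<in> U"
      then obtain i where "i \<in> {1..<n}" "\<sigma> ` {1..n - i} \<in> U" by blast
      then show "\<exists>i\<in>{1..<n}. \<sigma> ` {1..i} \<in> U" by (intro bexI[of _ "n - i"]) auto
    next
      assume "\<exists>i\<in>{1..<n}. \<sigma> ` {1..i} \<in> U"
      then obtain i where "i \<in> {1..<n}" "\<sigma> ` {1..i} \<in> U" by blast
      then show "\<exists>i\<in>{1..<n}. \<sigma> ` {1..n - i} \<in> U" by (intro bexI[of _ "n - i"]) auto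
    qed
    then show "of_bool (\<exists>i\<in>{1..<n}. \<sigma> ` I i \<in> compl_family n U) =
        (of_bool (\<exists>i\<in>{1..<n}. \<sigma> ` {1..i} \<in> U) :: real)"
      by (simp only: *)
  qed
  finally show ?thesis by (simp add: lubell_compl_family[OF U_subset])
qed

end

subsection \<open>Random cubes\<close>

text \<open>
  Positions of a set \<open>S \<union> Y\<^sub>t\<close>: the points \<open>{1..d}\<close> of the cube sit at the first \<open>l\<close> and the last
  \<open>d - l\<close> positions of the permutation, so that \<open>{1..l} \<union> Y\<^sub>t\<close> is an initial segment.
\<close>

definition cube_pos :: "nat \<Rightarrow> nat \<Rightarrow> nat \<Rightarrow> nat \<Rightarrow> nat set \<Rightarrow> nat set" where
  "cube_pos n d l t S = (\<lambda>i. if i \<le> l then i else n - d + i) ` S \<union> {l + 1..l + t}"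

lemma cube_pos:
  assumes "d \<le> n" "t \<le> n - d" "S \<subseteq> {1..d}" "l \<le> d"
  shows "cube_pos n d l t S \<subseteq> {1..n}" "card (cube_pos n d l t S) = card S + t"
proof -
  define h where "h i = (if i \<le> l then i else n - d + i)" for i
  have inj: "inj_on h {1..d}" using assms by (auto simp: inj_on_def h_def split: if_splits)
  have disj: "h ` S \<inter> {l + 1..l + t} = {}"
    using assms by (auto simp: h_def split: if_splits)
  have fin: "finite S" using assms(3) finite_subset by blast
  have eq: "cube_pos n d l t S = h ` S \<union> {l + 1..l + t}" by (simp add: cube_pos_def h_def)
  show "cube_pos n d l t S \<subseteq> {1..n}"
  proof -
    have "h ` {1..d} \<subseteq> {1..n}" using assms by (auto simp: h_def)
    moreover have "{l + 1..l + t} \<subseteq> {1..n}" using assms by auto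
    ultimately show ?thesis unfolding eq using assms(3) by blast
  qed
  show "card (cube_pos n d l t S) = card S + t"
    unfolding eq using disj fin inj_on_subset[OF inj assms(3)]
    by (simp add: card_Un_disjoint card_image)
qed

lemma cube_pos_Int:
  assumes "d \<le> n" "t \<le> n - d" "S \<subseteq> {1..d}" "S' \<subseteq> {1..d}" "l \<le> d"
  shows "cube_pos n d l t S \<inter> cube_pos n d l t S' = cube_pos n d l t (S \<inter> S')"
proof -
  define h where "h i = (if i \<le> l then i else n - d + i)" for i
  have inj: "inj_on h {1..d}" using assms by (auto simp: inj_on_def h_def split: if_splits)
  have eq: "cube_pos n d l t X = h ` X \<union> {l + 1..l + t}" for X by (simp add: cube_pos_def h_def)
  have "h ` (S \<inter> S') = h ` S \<inter> h ` S'"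
    using inj assms(3,4) by (rule inj_on_image_Int)
  then show ?thesis unfolding eq by blast
qed

text \<open>For each \<open>t\<close> the two position sets have size \<open>j + t\<close> and share
  all but one position, so they form an exchange at level \<open>j + t\<close>. Distinct
  \<open>t\<close> use distinct levels, hence the whole sum over \<open>t\<close> costs only one sum
  of exchange probabilities.\<close>

lemma sum_perm_prob_cube_exchange_le:
  assumes "d \<le> n" "l \<le> d" "S \<in> layer d j" "S' \<in> layer d j" "Suc (card (S \<inter> S')) = j"
  shows "(\<Sum>t\<le>n - d. perm_prob n (\<lambda>\<sigma>. \<sigma> ` cube_pos n d l t S \<in> G \<and> \<sigma> ` cube_pos n d l t S' \<notin> G))
    \<le> (\<Sum>i\<in>{1..<n}. exchange_prob n G i)"
proof -
  have S: "S \<subseteq> {1..d}" "card S = j" "S' \<subseteq> {1..d}" "card S' = j" "S \<inter> S' \<subseteq> {1..d}"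
    using assms by (auto simp: layer_def)
  have *: "perm_prob n (\<lambda>\<sigma>. \<sigma> ` cube_pos n d l t S \<in> G \<and> \<sigma> ` cube_pos n d l t S' \<notin> G)
      = exchange_prob n G (j + t) \<and> j + t \<in> {1..<n}" if t: "t \<le> n - d" for t
  proof -
    have "card (cube_pos n d l t S \<inter> cube_pos n d l t S') = card (S \<inter> S') + t"
      using cube_pos_Int[of d n t S S' l] cube_pos(2)[of d n t "S \<inter> S'" l] S t assms(1,2) by simp
    then have "Suc (card (cube_pos n d l t S \<inter> cube_pos n d l t S')) = j + t"
      using assms(5) by simp
    moreover have "cube_pos n d l t S \<subseteq> {1..n}" "cube_pos n d l t S' \<subseteq> {1..n}"
      "card (cube_pos n d l t S) = j + t" "card (cube_pos n d l t S') = j + t"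
      using S t assms(1,2) cube_pos by metis+
    ultimately show ?thesis using perm_prob_exchange by blast
  qed
  have "(\<Sum>t\<le>n - d. perm_prob n (\<lambda>\<sigma>. \<sigma> ` cube_pos n d l t S \<in> G \<and> \<sigma> ` cube_pos n d l t S' \<notin> G))
      = (\<Sum>t\<le>n - d. exchange_prob n G (j + t))"
    using * by (intro sum.cong) auto
  also have "\<dots> = (\<Sum>i\<in>(+) j ` {..n - d}. exchange_prob n G i)"
    by (simp add: sum.reindex)
  also have "\<dots> \<le> (\<Sum>i\<in>{1..<n}. exchange_prob n G i)"
    using * by (intro sum_mono2) (auto simp: exchange_prob_nonneg)
  finally show ?thesis .
qed

text \<open>Replace a point of \<open>S - S0\<close> by a point of \<open>S0 - S\<close>. The
  overlap with \<open>S0\<close> grows, so repeated exchanges lead to \<open>S0\<close>.\<close>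

lemma layer_exchange:
  assumes "S \<in> layer d j" "S0 \<in> layer d j" "S \<noteq> S0"
  obtains S' where "S' \<in> layer d j" "Suc (card (S' \<inter> S)) = j" "card (S \<inter> S0) < card (S' \<inter> S0)"
proof -
  have S: "S \<subseteq> {1..d}" "card S = j" "S0 \<subseteq> {1..d}" "card S0 = j" "finite S" "finite S0"
    using assms by (auto simp: layer_def intro: finite_subset)
  obtain x where x: "x \<in> S" "x \<notin> S0"
    using S assms(3) by (metis card_subset_eq subsetI)
  obtain y where y: "y \<in> S0" "y \<notin> S"
    using S assms(3) by (metis card_subset_eq subsetI)
  define S' where "S' = insert y (S - {x})"
  have card': "Suc (card (S - {x})) = j" using S x by (metis card_Suc_Diff1)
  have "card S' = j" using card' S y by (simp add: S'_def del: card_Diff_insert)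
  then have "S' \<in> layer d j" using S x y by (auto simp: layer_def S'_def)
  moreover have "S' \<inter> S = S - {x}" using y by (auto simp: S'_def)
  then have "Suc (card (S' \<inter> S)) = j" using card' by simp
  moreover have "S' \<inter> S0 = insert y (S \<inter> S0)" using x y by (auto simp: S'_def)
  then have "card (S \<inter> S0) < card (S' \<inter> S0)" using S y by simp
  ultimately show ?thesis by (rule that)
qed

lemma finite_layer: "finite (layer d j)" and card_layer: "card (layer d j) = d choose j"
  using n_subsets[of "{1..d}" j] by (auto simp: layer_def)

text \<open>If \<open>S0\<close> succeeds and some set fails, then a failing set of largest overlap
  with \<open>S0\<close> has a succeeding parent, so an exchange fails along a tree edge. The union
  bound runs over the \<open>(d choose j) - 1\<close> edges.\<close>

lemma perm_prob_layer_not_uniform_le: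
  assumes "d \<le> n" "l \<le> d" and S0: "S0 \<in> layer d j"
  shows "perm_prob n (\<lambda>\<sigma>. \<exists>t\<le>n - d. \<sigma> ` cube_pos n d l t S0 \<in> G \<and>
      (\<exists>S\<in>layer d j. \<sigma> ` cube_pos n d l t S \<notin> G))
    \<le> (real (d choose j) - 1) * (\<Sum>i\<in>{1..<n}. exchange_prob n G i)"
proof -
  \<comment> \<open>\<open>p\<close> is the parent map of a spanning tree of exchanges rooted at \<open>S0\<close>.\<close>
  have "\<forall>S\<in>layer d j - {S0}. \<exists>S'. S' \<in> layer d j \<and> Suc (card (S' \<inter> S)) = j \<and> card (S \<inter> S0) < card (S' \<inter> S0)"
  proof
    fix S assume S: "S \<in> layer d j - {S0}"
    then obtain S' where "S' \<in> layer d j" "Suc (card (S' \<inter> S)) = j" "card (S \<inter> S0) < card (S' \<inter> S0)"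
      using layer_exchange[of S d j S0] S0 by auto
    then show "\<exists>S'. S' \<in> layer d j \<and> Suc (card (S' \<inter> S)) = j \<and> card (S \<inter> S0) < card (S' \<inter> S0)" by blast
  qed
  then obtain p where p: "\<And>S. S \<in> layer d j - {S0} \<Longrightarrow> p S \<in> layer d j \<and> Suc (card (p S \<inter> S)) = j \<and> card (S \<inter> S0) < card (p S \<inter> S0)"
    by metis
  define E where "E t S \<sigma> \<longleftrightarrow> \<sigma> ` cube_pos n d l t (p S) \<in> G \<and> \<sigma> ` cube_pos n d l t S \<notin> G" for t S \<sigma>
  define Q where "Q = (layer d j - {S0}) \<times> {..n - d}"
  have finQ: "finite Q" by (simp add: Q_def finite_layer)
  have "perm_prob n (\<lambda>\<sigma>. \<exists>t\<le>n - d. \<sigma> ` cube_pos n d l t S0 \<in> G \<and>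
      (\<exists>S\<in>layer d j. \<sigma> ` cube_pos n d l t S \<notin> G)) \<le> perm_avg n (\<lambda>\<sigma>. \<Sum>(S, t)\<in>Q. of_bool (E t S \<sigma>))"
  proof (rule perm_avg_mono)
    fix \<sigma>
    show "of_bool (\<exists>t\<le>n - d. \<sigma> ` cube_pos n d l t S0 \<in> G \<and> (\<exists>S\<in>layer d j. \<sigma> ` cube_pos n d l t S \<notin> G))
        \<le> (\<Sum>(S, t)\<in>Q. of_bool (E t S \<sigma>) :: real)"
    proof (cases "\<exists>t\<le>n - d. \<sigma> ` cube_pos n d l t S0 \<in> G \<and> (\<exists>S\<in>layer d j. \<sigma> ` cube_pos n d l t S \<notin> G)")
      case False
      show ?thesis unfolding of_bool_def if_not_P[OF False] by (intro sum_nonneg) auto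
    next
      case True
      then obtain t where t: "t \<le> n - d" "\<sigma> ` cube_pos n d l t S0 \<in> G"
        and ex: "\<exists>S. S \<in> layer d j \<and> \<sigma> ` cube_pos n d l t S \<notin> G" by blast
      define bad where "bad = {S\<in>layer d j. \<sigma> ` cube_pos n d l t S \<notin> G}"
      have "finite ((\<lambda>S. card (S \<inter> S0)) ` bad)" "(\<lambda>S. card (S \<inter> S0)) ` bad \<noteq> {}"
        using ex by (auto simp: bad_def finite_layer)
      then have "Max ((\<lambda>S. card (S \<inter> S0)) ` bad) \<in> (\<lambda>S. card (S \<inter> S0)) ` bad" by (rule Max_in)
      then obtain S where S: "S \<in> bad" "card (S \<inter> S0) = Max ((\<lambda>S. card (S \<inter> S0)) ` bad)" by auto
      have max: "card (X \<inter> S0) \<le> card (S \<inter> S0)" if "X \<in> bad" for X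
        unfolding S(2) using that by (intro Max_ge) (auto simp: bad_def finite_layer)
      have SL: "S \<in> layer d j - {S0}" using S t by (auto simp: bad_def)
      have "p S \<notin> bad" using max[of "p S"] p[OF SL] by auto
      then have "E t S \<sigma>" using p[OF SL] S by (auto simp: bad_def E_def)
      \<comment> \<open>The one-point set \<open>{()}\<close> serves as index set, so the bound says
        that a single witness makes the sum at least 1.\<close>
      then have "real (card {()}) \<le> (\<Sum>(S, t)\<in>Q. of_bool (E t S \<sigma>))"
        by (intro card_le_sum_real[where g = "\<lambda>_. (S, t)"]) (use SL t finQ in \<open>auto simp: Q_def\<close>)
      then show ?thesis using True by simp
    qed
  qed
  also have "\<dots> = (\<Sum>(S, t)\<in>Q. perm_prob n (E t S))"
    by (simp add: perm_avg_sum case_prod_beta)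
  also have "\<dots> = (\<Sum>S\<in>layer d j - {S0}. \<Sum>t\<le>n - d. perm_prob n (E t S))"
    unfolding Q_def by (rule sum.cartesian_product[symmetric])
  also have "\<dots> \<le> (\<Sum>S\<in>layer d j - {S0}. \<Sum>i\<in>{1..<n}. exchange_prob n G i)"
    unfolding E_def
    by (intro sum_mono sum_perm_prob_cube_exchange_le[OF assms(1,2)]) (use p in auto)
  also have "\<dots> = real (card (layer d j - {S0})) * (\<Sum>i\<in>{1..<n}. exchange_prob n G i)" by simp
  also have "real (card (layer d j - {S0})) = real (d choose j) - 1"
  proof -
    have "card (layer d j) = Suc (card (layer d j - {S0}))"
      by (rule card.remove[OF finite_layer S0])
    then show ?thesis by (simp add: card_layer)
  qed
  finally show ?thesis .
qed

text \<open>The assumption \<open>few\<close> makes chains that meet \<open>U\<close> below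
  \<open>L\<close> rare.\<close>

locale two_sided = L: thin n m r L + U: cothin n m r U
  for n m r :: nat and L U :: "nat set set" +
  fixes d l :: nat
  assumes disjoint: "L \<inter> U = {}" and few: "\<And>B. B \<in> L \<Longrightarrow> card {A \<in> U. A \<subset> B} \<le> r"
    and ld: "l < d" "d < m" "m \<le> n"
begin

lemma of_bool_le_add: "X \<longrightarrow> Y \<or> Z \<Longrightarrow> of_bool X \<le> of_bool Y + (of_bool Z :: real)"
  by auto

lemma hit_in_range:
  assumes "\<sigma> permutes {1..n}" "\<sigma> ` {1..i} \<in> L \<union> U" "i \<le> n"
  shows "i \<in> {m..n - m}"
proof -
  have "card (\<sigma> ` {1..i}) = i"
    using permutes_inj_on[OF assms(1)] by (simp add: card_image)
  then show ?thesis using L.card_bounds U.card_bounds assms(2) by fastforce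
qed

text \<open>By inclusion-exclusion a chain usually meets both families, with \<open>L\<close> below
  \<open>U\<close>. The lower hit is already a prefix, while the upper one must use the position of
  the cube point \<open>l + 1\<close>, so it is moved by a transposition. The four errors
  \<open>2 * r / m\<close> come from hitting \<open>L\<close>, hitting \<open>U\<close>, the wrong
  order, and double hits of \<open>U\<close>.\<close>

lemma perm_prob_base_pair_ge:
  "perm_prob n (\<lambda>\<sigma>. \<exists>t u. t \<le> u \<and> u \<le> n - d \<and> \<sigma> ` cube_pos n d l t {1..l} \<in> L \<and>
      \<sigma> ` cube_pos n d l u {1..l + 1} \<in> U)
    \<ge> lubell n L + lubell n U - 1 - 8 * r / m" (is "perm_prob n ?good \<ge> _")
proof -
  define K where "K = {m..n - m}"
  \<comment> \<open>The position of the cube point \<open>l + 1\<close>. For \<open>k\<close> in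
    \<open>K\<close> it lies beyond the prefix \<open>{1..<k}\<close>, and \<open>I k\<close> is the
    position set of \<open>{1..l + 1}\<close> together with the first \<open>k - l - 1\<close> chain
    points.\<close>
  define x where "x = n - d + l + 1"
  define I where "I k = insert x {1..<k}" for k
  define Q where "Q = Sigma K (\<lambda>i. {k\<in>K. i < k})"
  define hitL where "hitL \<sigma> \<longleftrightarrow> (\<exists>i\<in>{1..<n}. \<sigma> ` {1..i} \<in> L)" for \<sigma>
  define hitU where "hitU \<sigma> \<longleftrightarrow> (\<exists>i\<in>{1..<n}. \<sigma> ` {1..i} \<in> U)" for \<sigma>
  define below where "below k \<sigma> \<longleftrightarrow> (\<exists>i\<in>K. i < k \<and> \<sigma> ` {1..i} \<in> L)" for k \<sigma>
  define UL where "UL \<sigma> = (\<Sum>(k, i)\<in>Q. of_bool (\<sigma> ` {1..k} \<in> U \<and> \<sigma> ` {1..i} \<in> L) :: real)" for \<sigma>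
  define UU where "UU \<sigma> = (\<Sum>(i, k)\<in>Q. of_bool (\<sigma> ` I i \<in> U \<and> \<sigma> ` I k \<in> U) :: real)" for \<sigma>
  have fin: "finite K" "finite Q" by (auto simp: K_def Q_def)
  have K: "k < x" "k \<ge> 1" "l < k" "k - l - 1 \<le> n - d" "k \<le> n" if "k \<in> K" for k
    using that ld by (auto simp: K_def x_def)
  have x: "x \<in> {1..n}" using ld by (auto simp: x_def)
  have cardI: "I k \<subseteq> {1..n} \<and> card (I k) = k" if "k \<in> K" for k
    using K[OF that] x by (auto simp: I_def)
  have "lubell n L + lubell n U - 1 - 4 * (2 * r / m) \<le>
      (perm_prob n hitL + perm_prob n hitU - 1 - perm_avg n UL) - perm_avg n UU"
  proof -
    have "lubell n L - 2 * r / m \<le> perm_prob n hitL"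
      unfolding hitL_def by (rule L.hit_prob_ge) auto
    moreover have "lubell n U - 2 * r / m \<le> perm_prob n hitU"
      unfolding hitU_def by (rule U.hit_prob_ge)
    moreover have "perm_avg n UL \<le> 2 * r / m"
    proof -
      have "perm_avg n UL \<le> real r / real m * lubell n L"
        unfolding UL_def
      proof (rule expected_nested_pairs_le[OF L.L_subset U.U_subset L.m(1) _ _ few fin(2)])
        fix i k assume "(i, k) \<in> Q"
        then show "i < k \<and> {1..i} \<subseteq> {1..k} \<and> {1..k} \<subseteq> {1..n} \<and> card {1..i} = i \<and> card {1..k} = k"
          by (auto simp: Q_def K_def)
      qed (use L.card_bounds U.card_bounds L.m(1) in fastforce)+
      also have "\<dots> \<le> real r / real m * 2"
        using L.lubell_le(2) by (rule mult_left_mono) simp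
      finally show ?thesis by (simp add: mult.commute)
    qed
    moreover have "perm_avg n UU \<le> 2 * r / m"
      unfolding UU_def
    proof (rule U.expected_pairs_le[OF fin(2)])
      fix i k assume "(i, k) \<in> Q"
      then have ik: "i \<in> K" "k \<in> K" "i < k" by (auto simp: Q_def)
      then show "i < k \<and> I i \<subseteq> I k \<and> I k \<subseteq> {1..n} \<and> card (I i) = i \<and> card (I k) = k"
        using cardI[OF ik(1)] cardI[OF ik(2)] by (auto simp: I_def)
    qed
    ultimately show ?thesis by linarith
  qed
  also have "\<dots> = perm_avg n (\<lambda>\<sigma>. of_bool (hitL \<sigma>) + of_bool (hitU \<sigma>) - 1 - UL \<sigma>) - perm_avg n UU"
    by (simp add: perm_avg_add perm_avg_diff perm_avg_const)
  also have "perm_avg n (\<lambda>\<sigma>. of_bool (hitL \<sigma>) + of_bool (hitU \<sigma>) - 1 - UL \<sigma>) \<le>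
      perm_avg n (\<lambda>\<sigma>. \<Sum>k\<in>K. of_bool (\<sigma> ` {1..k} \<in> U \<and> below k \<sigma>))"
  proof (rule perm_avg_mono)
    fix \<sigma> assume s: "\<sigma> permutes {1..n}"
    define W where "W = (\<Sum>k\<in>K. of_bool (\<sigma> ` {1..k} \<in> U \<and> below k \<sigma>) :: real)"
    have nonneg: "W \<ge> 0" "UL \<sigma> \<ge> 0" by (auto simp: W_def UL_def intro!: sum_nonneg)
    show "of_bool (hitL \<sigma>) + of_bool (hitU \<sigma>) - 1 - UL \<sigma> \<le> (\<Sum>k\<in>K. of_bool (\<sigma> ` {1..k} \<in> U \<and> below k \<sigma>))"
      unfolding W_def[symmetric]
    proof (cases "hitL \<sigma> \<and> hitU \<sigma>")
      case False
      then show "of_bool (hitL \<sigma>) + of_bool (hitU \<sigma>) - 1 - UL \<sigma> \<le> W" using nonneg by auto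
    next
      case True
      then obtain i k where ik: "i \<in> {1..<n}" "\<sigma> ` {1..i} \<in> L" "k \<in> {1..<n}" "\<sigma> ` {1..k} \<in> U"
        by (auto simp: hitL_def hitU_def)
      then have "i \<noteq> k" using disjoint by auto
      have range: "i \<in> K" "k \<in> K"
        unfolding K_def by (rule hit_in_range[OF s]; use ik in simp)+
      have "W \<ge> 1 \<or> UL \<sigma> \<ge> 1"
      proof (cases "i < k")
        case True
        then have "real (card {()}) \<le> W"
          unfolding W_def
          by (intro card_le_sum_real[where g = "\<lambda>_. k"]) (use ik range fin in \<open>auto simp: below_def\<close>)
        then show ?thesis by simp
      next
        case False
        then have "real (card {()}) \<le> UL \<sigma>"
          unfolding UL_def
          by (intro card_le_sum_real[where g = "\<lambda>_. (k, i)"])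
            (use ik range fin \<open>i \<noteq> k\<close> in \<open>auto simp: Q_def\<close>)
        then show ?thesis by simp
      qed
      then show "of_bool (hitL \<sigma>) + of_bool (hitU \<sigma>) - 1 - UL \<sigma> \<le> W" using nonneg by auto
    qed
  qed
  also have "\<dots> = (\<Sum>k\<in>K. perm_prob n (\<lambda>\<sigma>. \<sigma> ` {1..k} \<in> U \<and> below k \<sigma>))"
    by (rule perm_avg_sum)
  \<comment> \<open>The transposition depends on \<open>k\<close>, so only the expectations are
    compared, term by term. This is why the event was first replaced by a count.\<close>
  also have "\<dots> = (\<Sum>k\<in>K. perm_prob n (\<lambda>\<sigma>. \<sigma> ` I k \<in> U \<and> below k \<sigma>))"
  proof (rule sum.cong[OF refl])
    fix k assume k: "k \<in> K"
    \<comment> \<open>This transposition turns the \<open>k\<close>-th prefix into \<open>I k\<close> and fixes all shorter prefixes.\<close>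
    define \<tau> where "\<tau> = transpose k x"
    have \<tau>: "\<tau> permutes {1..n}" unfolding \<tau>_def
      by (rule permutes_swap_id) (use K[OF k] x in auto)
    have low: "\<tau> ` {1..i} = {1..i}" if "i < k" for i
    proof -
      have "\<tau> ` {1..i} = id ` {1..i}"
        by (rule image_cong) (use that K[OF k] in \<open>auto simp: \<tau>_def transpose_def\<close>)
      then show ?thesis by simp
    qed
    have "{1..k} = insert k {1..k - 1}" "{1..<k} = {1..k - 1}" using K[OF k] by auto
    then have top: "\<tau> ` {1..k} = I k"
      using low[of "k - 1"] K[OF k] by (simp add: I_def \<tau>_def)
    have "(\<sigma> \<circ> \<tau>) ` {1..k} \<in> U \<and> below k (\<sigma> \<circ> \<tau>) \<longleftrightarrow> \<sigma> ` I k \<in> U \<and> below k \<sigma>" for \<sigma>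
    proof -
      have "below k (\<sigma> \<circ> \<tau>) \<longleftrightarrow> below k \<sigma>"
        unfolding below_def using low by (intro bex_cong[OF refl] conj_cong[OF refl]) (simp only: image_comp[symmetric] low)
      then show ?thesis by (simp only: image_comp[symmetric] top)
    qed
    then show "perm_prob n (\<lambda>\<sigma>. \<sigma> ` {1..k} \<in> U \<and> below k \<sigma>) = perm_prob n (\<lambda>\<sigma>. \<sigma> ` I k \<in> U \<and> below k \<sigma>)"
      using perm_avg_compose_right[OF \<tau>, of "\<lambda>\<sigma>. of_bool (\<sigma> ` {1..k} \<in> U \<and> below k \<sigma>)"] by simp
  qed
  also have "\<dots> = perm_avg n (\<lambda>\<sigma>. \<Sum>k\<in>K. of_bool (\<sigma> ` I k \<in> U \<and> below k \<sigma>))"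
    by (rule perm_avg_sum[symmetric])
  \<comment> \<open>Returning from the count to the event costs at most the nested pairs among the
    sets \<open>I k\<close> sent into \<open>U\<close>.\<close>
  also have "\<dots> \<le> perm_avg n (\<lambda>\<sigma>. of_bool (?good \<sigma>) + UU \<sigma>)"
  proof (rule perm_avg_mono)
    fix \<sigma> :: "nat \<Rightarrow> nat"
    define W where "W = (\<Sum>k\<in>K. of_bool (\<sigma> ` I k \<in> U \<and> below k \<sigma>) :: real)"
    have UU0: "UU \<sigma> \<ge> 0" by (auto simp: UU_def intro!: sum_nonneg)
    have good: "?good \<sigma>" if "k \<in> K" "\<sigma> ` I k \<in> U" "below k \<sigma>" for k
    proof -
      obtain i where i: "i \<in> K" "i < k" "\<sigma> ` {1..i} \<in> L"
        using \<open>below k \<sigma>\<close> by (auto simp: below_def)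
      have "cube_pos n d l (i - l) {1..l} = {1..i}"
      proof -
        have "(\<lambda>i. if i \<le> l then i else n - d + i) ` {1..l} = {1..l}" by (auto simp: image_iff)
        then show ?thesis using K[OF i(1)] by (auto simp: cube_pos_def)
      qed
      moreover have "cube_pos n d l (k - l - 1) {1..l + 1} = I k"
      proof -
        have "{1..l + 1} = insert (l + 1) {1..l}" by auto
        then have "(\<lambda>i. if i \<le> l then i else n - d + i) ` {1..l + 1} = insert x {1..l}"
          by (auto simp: image_iff x_def)
        then show ?thesis using K[OF that(1)] by (auto simp: cube_pos_def I_def)
      qed
      \<comment> \<open>The strict inequality \<open>i < k\<close> becomes
        \<open>i - l \<le> k - l - 1\<close>, which is the required
        \<open>t \<le> u\<close>.\<close>
      ultimately show ?thesis
        using i that K[OF i(1)] K[OF that(1)]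
        by (intro exI[of _ "i - l"] exI[of _ "k - l - 1"]) auto
    qed
    have "W \<le> of_bool (?good \<sigma>) + UU \<sigma>"
    proof (cases "?good \<sigma>")
      case False
      have "W = 0" unfolding W_def
      proof (rule sum.neutral, rule ballI)
        fix k assume "k \<in> K"
        then have "\<not> (\<sigma> ` I k \<in> U \<and> below k \<sigma>)" using good[of k] False by blast
        then show "of_bool (\<sigma> ` I k \<in> U \<and> below k \<sigma>) = (0::real)" by simp
      qed
      then show ?thesis unfolding of_bool_def if_not_P[OF False] using UU0 by linarith
    next
      case True
      have "W \<le> (\<Sum>k\<in>K. of_bool (\<sigma> ` I k \<in> U))"
        unfolding W_def by (intro sum_mono) auto
      also have "\<dots> \<le> 1 + UU \<sigma>"
        using card_le_sum_separated_pairs[OF fin(1), of "\<lambda>k. \<sigma> ` I k \<in> U" 1]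
        by (simp add: UU_def Q_def Suc_le_eq)
      finally show ?thesis unfolding of_bool_def if_P[OF True] .
    qed
    then show "(\<Sum>k\<in>K. of_bool (\<sigma> ` I k \<in> U \<and> below k \<sigma>)) \<le> of_bool (?good \<sigma>) + UU \<sigma>"
      by (simp only: W_def)
  qed
  also have "\<dots> = perm_prob n ?good + perm_avg n UU" by (rule perm_avg_add)
  finally show ?thesis by simp
qed

text \<open>A base pair without a full cube forces a failure in one of the two layers. Comparing the
  probability of a base pair with those of the failures bounds the deficits \<open>x\<close> and
  \<open>y\<close> from below.\<close>

lemma lubell_sum_le:
  assumes no_cube: "\<And>\<sigma> t u. \<sigma> permutes {1..n} \<Longrightarrow> t \<le> u \<Longrightarrow> u \<le> n - d \<Longrightarrow>
    (\<forall>S\<in>layer d l. \<sigma> ` cube_pos n d l t S \<in> L) \<Longrightarrow> (\<forall>S\<in>layer d (l + 1). \<sigma> ` cube_pos n d l u S \<in> U) \<Longrightarrow> False"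
  shows "lubell n L + lubell n U \<le>
    2 - 1 / (2 * (real (d choose l) + real (d choose (l + 1)) - 1)) + 14 * r / m"
proof -
  define badL where "badL \<sigma> \<longleftrightarrow> (\<exists>t\<le>n - d. \<sigma> ` cube_pos n d l t {1..l} \<in> L \<and>
      (\<exists>S\<in>layer d l. \<sigma> ` cube_pos n d l t S \<notin> L))" for \<sigma>
  define badU where "badU \<sigma> \<longleftrightarrow> (\<exists>t\<le>n - d. \<sigma> ` cube_pos n d l t {1..l + 1} \<in> U \<and>
      (\<exists>S\<in>layer d (l + 1). \<sigma> ` cube_pos n d l t S \<notin> U))" for \<sigma>
  define a b where "a = real (d choose l)" and "b = real (d choose (l + 1))"
  define \<epsilon> where "\<epsilon> = 2 * real r / real m"
  define x y where "x = 1 - lubell n L" and "y = 1 - lubell n U"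
  have ab: "a \<ge> 1" "b \<ge> 1"
    using ld by (auto simp: a_def b_def Suc_le_eq zero_less_binomial_iff)
  have eps: "\<epsilon> \<ge> 0" "x \<ge> - \<epsilon>" "y \<ge> - \<epsilon>"
    using L.lubell_le(1) U.lubell_le by (auto simp: \<epsilon>_def x_def y_def)
  have "lubell n L + lubell n U - 1 - 8 * r / m \<le> perm_avg n (\<lambda>\<sigma>. of_bool (badL \<sigma>) + of_bool (badU \<sigma>))"
  proof (rule order_trans[OF perm_prob_base_pair_ge perm_avg_mono])
    fix \<sigma> assume s: "\<sigma> permutes {1..n}"
    have "badL \<sigma> \<or> badU \<sigma>" if tu: "t \<le> u" "u \<le> n - d" "\<sigma> ` cube_pos n d l t {1..l} \<in> L"
      "\<sigma> ` cube_pos n d l u {1..l + 1} \<in> U" for t u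
    proof (rule ccontr)
      assume *: "\<not> (badL \<sigma> \<or> badU \<sigma>)"
      have "t \<le> n - d" using tu by simp
      with * tu(3) have "\<forall>S\<in>layer d l. \<sigma> ` cube_pos n d l t S \<in> L"
        unfolding badL_def by blast
      moreover from * tu(2,4) have "\<forall>S\<in>layer d (l + 1). \<sigma> ` cube_pos n d l u S \<in> U"
        unfolding badU_def by blast
      ultimately show False by (rule no_cube[OF s tu(1,2)])
    qed
    then have "(\<exists>t u. t \<le> u \<and> u \<le> n - d \<and> \<sigma> ` cube_pos n d l t {1..l} \<in> L \<and>
        \<sigma> ` cube_pos n d l u {1..l + 1} \<in> U) \<longrightarrow> badL \<sigma> \<or> badU \<sigma>" by blast
    then show "of_bool (\<exists>t u. t \<le> u \<and> u \<le> n - d \<and> \<sigma> ` cube_pos n d l t {1..l} \<in> L \<and>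
        \<sigma> ` cube_pos n d l u {1..l + 1} \<in> U) \<le> of_bool (badL \<sigma>) + (of_bool (badU \<sigma>) :: real)"
      by (rule of_bool_le_add)
  qed
  also have "\<dots> = perm_prob n badL + perm_prob n badU" by (rule perm_avg_add)
  also have "\<dots> \<le> (a - 1) * (2 * x + 5 * \<epsilon>) + (b - 1) * (2 * y + 5 * \<epsilon>)"
  proof (rule add_mono)
    have "perm_prob n badL \<le> (a - 1) * (\<Sum>i\<in>{1..<n}. exchange_prob n L i)"
      unfolding a_def badL_def
      by (rule perm_prob_layer_not_uniform_le) (use ld in \<open>auto simp: layer_def\<close>)
    also have "\<dots> \<le> (a - 1) * (2 * x + 5 * \<epsilon>)"
      using L.sum_exchange_prob_le ab by (intro mult_left_mono) (auto simp: x_def \<epsilon>_def)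
    finally show "perm_prob n badL \<le> (a - 1) * (2 * x + 5 * \<epsilon>)" .
    have "perm_prob n badU \<le> (b - 1) * (\<Sum>i\<in>{1..<n}. exchange_prob n U i)"
      unfolding b_def badU_def
      by (rule perm_prob_layer_not_uniform_le) (use ld in \<open>auto simp: layer_def\<close>)
    also have "\<dots> \<le> (b - 1) * (2 * y + 5 * \<epsilon>)"
      using U.sum_exchange_prob_le ab by (intro mult_left_mono) (auto simp: y_def \<epsilon>_def)
    finally show "perm_prob n badU \<le> (b - 1) * (2 * y + 5 * \<epsilon>)" .
  qed
  finally have "1 - x - y - 4 * \<epsilon> \<le> (a - 1) * (2 * x + 5 * \<epsilon>) + (b - 1) * (2 * y + 5 * \<epsilon>)"
    by (simp add: x_def y_def \<epsilon>_def)
  \<comment> \<open>The shifted deficits \<open>x + \<epsilon>\<close> and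
    \<open>y + \<epsilon>\<close> are nonnegative, so both coefficients may be raised to the common
    value \<open>2 * (a + b - 1)\<close>.\<close>
  then have "1 + (2 * a - 1) * \<epsilon> + (2 * b - 1) * \<epsilon> \<le> (2 * a - 1) * (x + \<epsilon>) + (2 * b - 1) * (y + \<epsilon>) + (5 * (a + b) - 6) * \<epsilon>"
    by (simp add: algebra_simps)
  also have "\<dots> \<le> (2 * (a + b - 1)) * (x + \<epsilon>) + (2 * (a + b - 1)) * (y + \<epsilon>) + (5 * (a + b) - 6) * \<epsilon>"
    using ab eps by (intro add_mono mult_right_mono) auto
  finally have "1 \<le> 2 * (a + b - 1) * (x + y + 2 * \<epsilon>) + (3 * (a + b) - 4) * \<epsilon>"
    by (simp add: algebra_simps)
  also have "\<dots> \<le> 2 * (a + b - 1) * (x + y + 2 * \<epsilon>) + (10 * (a + b - 1)) * \<epsilon>"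
    using ab eps by (intro add_mono mult_right_mono) auto
  also have "\<dots> = (x + y + 7 * \<epsilon>) * (2 * (a + b - 1))"
    by (simp add: algebra_simps)
  finally have "1 / (2 * (a + b - 1)) \<le> x + y + 7 * \<epsilon>"
    using ab by (simp add: divide_le_eq)
  then show ?thesis
    by (simp add: x_def y_def \<epsilon>_def a_def b_def)
qed

end

text \<open>Intersections are preserved, so equal images force \<open>S \<inter> S'\<close> to have
  the full size \<open>j\<close>.\<close>

lemma inj_on_cube_pos:
  assumes "d \<le> n" "t \<le> n - d" "l \<le> d"
  shows "inj_on (cube_pos n d l t) (layer d j)"
proof (rule inj_onI)
  fix S S' assume S: "S \<in> layer d j" "S' \<in> layer d j" and eq: "cube_pos n d l t S = cube_pos n d l t S'"
  have S': "S \<subseteq> {1..d}" "card S = j" "S' \<subseteq> {1..d}" "card S' = j" "S \<inter> S' \<subseteq> {1..d}" "finite S" "finite S'"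
    using S by (auto simp: layer_def intro: finite_subset)
  have "cube_pos n d l t (S \<inter> S') = cube_pos n d l t S"
    using cube_pos_Int[of d n t S S' l] S' assms eq by simp
  then have "card (S \<inter> S') = j"
    using cube_pos(2)[of d n t S l] cube_pos(2)[of d n t "S \<inter> S'" l] S' assms by simp
  then have "S \<inter> S' = S" "S \<inter> S' = S'"
    using S' card_subset_eq[of S "S \<inter> S'"] card_subset_eq[of S' "S \<inter> S'"] by (metis Int_lower1, metis Int_lower2)
  then show "S = S'" by simp
qed

subsection \<open>Posets on two levels\<close>

locale two_level_poset =
  fixes P :: "'a set" and r :: "'a rel" and d l :: nat and \<phi> :: "'a \<Rightarrow> nat set"
  assumes finite_P: "finite P" and P_nonempty: "P \<noteq> {}" and ld: "l < d"
    and inj_\<phi>: "inj_on \<phi> P" and \<phi>: "\<phi> ` P \<subseteq> layer d l \<union> layer d (l + 1)"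
    and mono_\<phi>: "\<And>p q. p \<in> P \<Longrightarrow> q \<in> P \<Longrightarrow> (p, q) \<in> r \<Longrightarrow> \<phi> p \<subseteq> \<phi> q"
begin

definition lower :: "'a set" where "lower = {p\<in>P. \<phi> p \<in> layer d l}"
definition upper :: "'a set" where "upper = {p\<in>P. \<phi> p \<in> layer d (l + 1)}"

lemma lower_upper: "lower \<union> upper = P" "lower \<inter> upper = {}"
  using \<phi> by (auto simp: lower_def upper_def layer_def)

text \<open>A strict relation in \<open>P\<close> becomes a strict inclusion under
  \<open>\<phi>\<close>, which within two consecutive levels can only go from the lower to the upper
  one. So the two halves of \<open>P\<close> may be placed by separate injections.\<close>

lemma related_cases:
  assumes "p \<in> P" "q \<in> P" "(p, q) \<in> r"
  shows "p = q \<or> p \<in> lower \<and> q \<in> upper"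
proof -
  have sub: "\<phi> p \<subseteq> \<phi> q" using mono_\<phi> assms by blast
  have "\<phi> q \<subseteq> {1..d}" using \<phi> assms(2) by (auto simp: layer_def)
  then have fin: "finite (\<phi> q)" using finite_subset by blast
  show ?thesis
  proof (cases "card (\<phi> p) < card (\<phi> q)")
    case True
    moreover have "\<phi> p \<in> layer d l \<union> layer d (l + 1)" "\<phi> q \<in> layer d l \<union> layer d (l + 1)"
      using \<phi> assms(1,2) by blast+
    ultimately show ?thesis
      using assms(1,2) by (auto simp: lower_def upper_def layer_def)
  next
    case False
    then have "\<phi> p = \<phi> q" using sub fin by (intro card_seteq) auto
    then have "p = q" using inj_\<phi> assms(1,2) by (simp add: inj_on_eq_iff)
    then show ?thesis ..
  qed
qed

lemma not_poset_free:
  assumes "inj_on f lower" "inj_on g upper" "f ` lower \<inter> g ` upper = {}" "f ` lower \<union> g ` upper \<subseteq> F"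
    "\<And>p q. p \<in> lower \<Longrightarrow> q \<in> upper \<Longrightarrow> (p, q) \<in> r \<Longrightarrow> f p \<subseteq> g q"
  shows "\<not> poset_free P r F"
proof -
  define \<psi> where "\<psi> p = (if p \<in> lower then f p else g p)" for p
  have up: "p \<in> upper" if "p \<in> P" "p \<notin> lower" for p using lower_upper that by blast
  have notlow: "p \<notin> lower" if "p \<in> upper" for p using lower_upper that by blast
  have differ: "f p \<noteq> g q" if "p \<in> lower" "q \<in> upper" for p q
    using assms(3) that by blast
  have "inj_on \<psi> P"
  proof (rule inj_onI)
    fix p q assume pq: "p \<in> P" "q \<in> P" "\<psi> p = \<psi> q"
    consider "p \<in> lower" "q \<in> lower" | "p \<notin> lower" "q \<notin> lower"
      | "p \<in> lower" "q \<notin> lower" | "p \<notin> lower" "q \<in> lower" by blast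
    then show "p = q"
    proof cases
      case 1
      then show ?thesis using pq(3) assms(1) by (simp add: \<psi>_def inj_on_eq_iff)
    next
      case 2
      then show ?thesis using pq up assms(2) by (simp add: \<psi>_def inj_on_eq_iff)
    next
      case 3
      then show ?thesis using pq differ[of p q] up[of q] by (simp add: \<psi>_def)
    next
      case 4
      then show ?thesis using pq differ[of q p] up[of p] by (simp add: \<psi>_def)
    qed
  qed
  moreover have "\<psi> p \<subseteq> \<psi> q" if pq: "p \<in> P" "q \<in> P" "(p, q) \<in> r" for p q
    using related_cases[OF pq]
  proof
    assume "p \<in> lower \<and> q \<in> upper"
    then show ?thesis using assms(5)[of p q] notlow[of q] pq(3) by (simp add: \<psi>_def)
  qed simp
  ultimately have "weak_copy P r (\<psi> ` P)"
    unfolding weak_copy_def bij_betw_def by blast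
  moreover have "\<psi> ` P \<subseteq> F"
    using assms(4) up unfolding \<psi>_def by force
  ultimately show ?thesis by (auto simp: poset_free_def)
qed

text \<open>Placing \<open>lower\<close> below \<open>B\<close> and \<open>upper\<close> above
  \<open>B\<close> makes every required inclusion pass through \<open>B\<close>.\<close>

lemma not_poset_free_of_hub:
  assumes "finite F" "card P \<le> card {A\<in>F. A \<subset> B}" "card P \<le> card {A\<in>F. B \<subset> A}"
  shows "\<not> poset_free P r F"
proof -
  have fin: "finite lower" "finite upper" and "lower \<subseteq> P" "upper \<subseteq> P"
    using lower_upper finite_P by (auto simp: lower_def upper_def)
  then have "card lower \<le> card {A\<in>F. A \<subset> B}" "card upper \<le> card {A\<in>F. B \<subset> A}"
    using card_mono[OF finite_P] assms(2,3) order_trans by blast+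
  then obtain f g where f: "f ` lower \<subseteq> {A\<in>F. A \<subset> B}" "inj_on f lower"
    and g: "g ` upper \<subseteq> {A\<in>F. B \<subset> A}" "inj_on g upper"
    using card_le_inj[OF fin(1), of "{A\<in>F. A \<subset> B}"] card_le_inj[OF fin(2), of "{A\<in>F. B \<subset> A}"] assms(1)
    by auto
  show ?thesis
  proof (rule not_poset_free[OF f(2) g(2)])
    show "f ` lower \<inter> g ` upper = {}" using f(1) g(1) by blast
    show "f ` lower \<union> g ` upper \<subseteq> F" using f(1) g(1) by blast
    show "f p \<subseteq> g q" if "p \<in> lower" "q \<in> upper" for p q using f(1) g(1) that by blast
  qed
qed

text \<open>With threshold \<open>card P\<close>, members of \<open>L\<close> have few members below
  by definition, and members of \<open>U\<close> have few above since they would otherwise be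
  hubs.\<close>

lemma lubell_le:
  assumes F: "F \<subseteq> Pow {1..n}" "poset_free P r F" and sizes: "\<And>B. B \<in> F \<Longrightarrow> m \<le> card B \<and> card B + m \<le> n"
    and m: "d < m" "2 * card P \<le> m" "m \<le> n"
  shows "lubell n F \<le> 2 - 1 / (2 * (real (d choose l) + real (d choose (l + 1)) - 1)) + 14 * card P / m"
proof -
  define U where "U = {B\<in>F. card P \<le> card {A\<in>F. A \<subset> B}}"
  define L where "L = F - U"
  have finF: "finite F" using F finite_subset by blast
  have sub: "U \<subseteq> F" "L \<subseteq> F" "L \<union> U = F" "L \<inter> U = {}" by (auto simp: U_def L_def)
  have few: "card {A\<in>X. A \<subset> B} \<le> card P" if "B \<in> L" "X \<subseteq> F" for X B
  proof -
    have "card {A\<in>X. A \<subset> B} \<le> card {A\<in>F. A \<subset> B}"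
      using that(2) finF by (intro card_mono) auto
    then show ?thesis using that(1) by (auto simp: L_def U_def)
  qed
  have fewU: "card {A\<in>F. B \<subset> A} \<le> card P" if "B \<in> U" for B
    using not_poset_free_of_hub[OF finF, of B] F(2) that by (force simp: U_def)
  have "thin_family n m (card P) L"
    unfolding thin_family_def using F(1) sub few[of _ L] sizes by blast
  moreover have "thin_family n m (card P) (compl_family n U)"
    unfolding thin_family_def
  proof (intro conjI ballI)
    show "compl_family n U \<subseteq> Pow {1..n}" by (auto simp: compl_family_def)
    fix C assume "C \<in> compl_family n U"
    then obtain B where B: "B \<in> U" "C = {1..n} - B" by (auto simp: compl_family_def)
    then have Bn: "B \<subseteq> {1..n}" "B \<in> F" using sub F(1) by auto
    then have cC: "card C = n - card B" "card B \<le> n"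
      using B card_mono[of "{1..n}" B] by (auto simp: card_Diff_subset finite_subset)
    then show "m \<le> card C" "card C + m \<le> n" using sizes[OF Bn(2)] by auto
    have "{A \<in> compl_family n U. A \<subset> C} \<subseteq> (\<lambda>A. {1..n} - A) ` {A\<in>F. B \<subset> A}"
    proof
      fix A assume "A \<in> {A \<in> compl_family n U. A \<subset> C}"
      then obtain A' where A': "A' \<in> U" "A = {1..n} - A'" "A \<subset> C" by (auto simp: compl_family_def)
      then have "A' \<subseteq> {1..n}" "A' \<in> F" using sub F(1) by auto
      moreover from this have "B \<subset> A'" using A' B Bn by blast
      ultimately show "A \<in> (\<lambda>A. {1..n} - A) ` {A\<in>F. B \<subset> A}" using A' by blast
    qed
    then have "card {A \<in> compl_family n U. A \<subset> C} \<le> card {A\<in>F. B \<subset> A}"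
      using finF by (intro surj_card_le) auto
    then show "card {A \<in> compl_family n U. A \<subset> C} \<le> card P"
      using fewU[OF B(1)] by simp
  qed
  ultimately interpret two_sided n m "card P" L U d l
    using m ld sub F(1) few[of _ U] by unfold_locales auto
  have "lubell n L + lubell n U \<le>
    2 - 1 / (2 * (real (d choose l) + real (d choose (l + 1)) - 1)) + 14 * card P / m"
  proof (rule lubell_sum_le)
    fix \<sigma> t u
    assume s: "\<sigma> permutes {1..n}" and tu: "t \<le> u" "u \<le> n - d"
      and all: "\<forall>S\<in>layer d l. \<sigma> ` cube_pos n d l t S \<in> L" "\<forall>S\<in>layer d (l + 1). \<sigma> ` cube_pos n d l u S \<in> U"
    have dn: "d \<le> n" "l \<le> d" "t \<le> n - d" using m ld tu by auto
    have inj: "inj_on (\<lambda>p. \<sigma> ` cube_pos n d l t' (\<phi> p)) X"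
      if "X \<subseteq> P" "\<phi> ` X \<subseteq> layer d j" "t' \<le> n - d" for t' X j
    proof (rule inj_onI)
      fix p q assume pq: "p \<in> X" "q \<in> X" "\<sigma> ` cube_pos n d l t' (\<phi> p) = \<sigma> ` cube_pos n d l t' (\<phi> q)"
      then have "cube_pos n d l t' (\<phi> p) = cube_pos n d l t' (\<phi> q)"
        using inj_image_eq_iff[OF permutes_inj[OF s]] by blast
      then have "\<phi> p = \<phi> q"
        using inj_onD[OF inj_on_cube_pos[OF dn(1) that(3) dn(2), of j]] pq that(2) by blast
      then show "p = q" using inj_onD[OF inj_\<phi>] pq that(1) by blast
    qed
    \<comment> \<open>The full layers receive \<open>lower\<close> at height \<open>t\<close> and
      \<open>upper\<close> at height \<open>u\<close>; the chain parts are nested because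
      \<open>t \<le> u\<close>.\<close>
    have "\<not> poset_free P r F"
    proof (rule not_poset_free)
      show "inj_on (\<lambda>p. \<sigma> ` cube_pos n d l t (\<phi> p)) lower"
        by (rule inj[where j = l]) (use dn in \<open>auto simp: lower_def\<close>)
      show "inj_on (\<lambda>p. \<sigma> ` cube_pos n d l u (\<phi> p)) upper"
        by (rule inj[where j = "l + 1"]) (use tu in \<open>auto simp: upper_def\<close>)
      have low: "(\<lambda>p. \<sigma> ` cube_pos n d l t (\<phi> p)) ` lower \<subseteq> L"
        and up: "(\<lambda>p. \<sigma> ` cube_pos n d l u (\<phi> p)) ` upper \<subseteq> U"
        using all by (auto simp: lower_def upper_def)
      show "(\<lambda>p. \<sigma> ` cube_pos n d l t (\<phi> p)) ` lower \<inter> (\<lambda>p. \<sigma> ` cube_pos n d l u (\<phi> p)) ` upper = {}"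
        using low up sub(4) by blast
      show "(\<lambda>p. \<sigma> ` cube_pos n d l t (\<phi> p)) ` lower \<union> (\<lambda>p. \<sigma> ` cube_pos n d l u (\<phi> p)) ` upper \<subseteq> F"
        using low up sub by blast
      fix p q assume "p \<in> lower" "q \<in> upper" "(p, q) \<in> r"
      then have "\<phi> p \<subseteq> \<phi> q" using mono_\<phi> by (auto simp: lower_def upper_def)
      then have "cube_pos n d l t (\<phi> p) \<subseteq> cube_pos n d l u (\<phi> q)"
        using tu(1) by (fastforce simp: cube_pos_def)
      then show "\<sigma> ` cube_pos n d l t (\<phi> p) \<subseteq> \<sigma> ` cube_pos n d l u (\<phi> q)" by blast
    qed
    then show False using F(2) by simp
  qed
  moreover have "lubell n F = lubell n L + lubell n U"
    unfolding lubell_def using sub finF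
    by (metis finite_subset sum.union_disjoint)
  ultimately show ?thesis by simp
qed

end

section \<open>From Lubell mass to cardinality and the limit\<close>

lemma card_le_lubell:
  assumes "F \<subseteq> Pow {1..n}"
  shows "real (card F) \<le> real (n choose (n div 2)) * lubell n F"
proof -
  have "1 \<le> real (n choose (n div 2)) * (1 / real (n choose card B))" if "B \<in> F" for B
  proof -
    have "card B \<le> n" using assms that card_mono[of "{1..n}" B] by auto
    then have "0 < n choose card B" by (simp add: zero_less_binomial_iff)
    then show ?thesis using binomial_maximum[of n "card B"] by (simp add: field_simps)
  qed
  then have "(\<Sum>B\<in>F. 1) \<le> (\<Sum>B\<in>F. real (n choose (n div 2)) * (1 / real (n choose card B)))"
    by (intro sum_mono)
  then show ?thesis by (simp add: lubell_def sum_distrib_left)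
qed

text \<open>The absorption identities give
  \<open>(n - i) * (n choose i) = Suc i * (n choose Suc i)\<close>, and the right side is at most
  \<open>m\<close> times the middle binomial coefficient.\<close>

lemma binomial_small_le:
  assumes "i < m" "m < n"
  shows "real (n choose i) \<le> real m / real (n - m) * real (n choose (n div 2))"
proof -
  have "(n - i) * (n choose i) = Suc i * (n choose Suc i)"
    by (metis binomial_absorb_comp binomial_absorption)
  also have "\<dots> \<le> m * (n choose (n div 2))"
    using assms(1) binomial_maximum by (intro mult_mono) auto
  finally have "(n - i) * (n choose i) \<le> m * (n choose (n div 2))" .
  moreover have "(n - m) * (n choose i) \<le> (n - i) * (n choose i)"
    using assms(1) by (intro mult_right_mono diff_le_mono2) auto
  ultimately have "(n - m) * (n choose i) \<le> m * (n choose (n div 2))" by linarith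
  then have "real (n - m) * real (n choose i) \<le> real m * real (n choose (n div 2))"
    by (metis of_nat_le_iff of_nat_mult)
  then show ?thesis using assms(2) by (simp add: field_simps)
qed

text \<open>At most \<open>2 * m\<close> layers are involved. For fixed \<open>m\<close> their total
  size is negligible against the middle layer as \<open>n\<close> grows.\<close>

lemma card_extreme_le:
  assumes "m < n" "F \<subseteq> Pow {1..n}" "\<And>B. B \<in> F \<Longrightarrow> card B < m \<or> n < card B + m"
  shows "real (card F) \<le> 2 * real m ^ 2 / real (n - m) * real (n choose (n div 2))"
proof -
  define c where "c = real m / real (n - m) * real (n choose (n div 2))"
  have "F \<subseteq> (\<Union>i<m. layer n i \<union> layer n (n - i))"
  proof
    fix B assume B: "B \<in> F"
    then have Bn: "B \<subseteq> {1..n}" "card B \<le> n" using assms(2) card_mono[of "{1..n}" B] by auto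
    consider "card B < m" | "n < card B + m" using assms(3)[OF B] by blast
    then show "B \<in> (\<Union>i<m. layer n i \<union> layer n (n - i))"
    proof cases
      case 1
      then show ?thesis using Bn by (auto simp: layer_def)
    next
      case 2
      then show ?thesis using Bn by (auto simp: layer_def intro!: bexI[of _ "n - card B"])
    qed
  qed
  then have "card F \<le> card (\<Union>i<m. layer n i \<union> layer n (n - i))"
    by (intro card_mono) (auto simp: finite_layer)
  also have "\<dots> \<le> (\<Sum>i<m. card (layer n i \<union> layer n (n - i)))"
    by (rule card_UN_le) simp
  also have "\<dots> \<le> (\<Sum>i<m. (n choose i) + (n choose (n - i)))"
    by (intro sum_mono) (use card_Un_le card_layer in metis)
  also have "\<dots> = (\<Sum>i<m. 2 * (n choose i))"
    using assms(1) by (intro sum.cong) (auto simp: binomial_symmetric[symmetric])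
  finally have "real (card F) \<le> (\<Sum>i<m. 2 * real (n choose i))"
    by (metis (mono_tags, lifting) of_nat_le_iff of_nat_mult of_nat_numeral of_nat_sum sum.cong)
  also have "\<dots> \<le> (\<Sum>i<m. 2 * c)"
    unfolding c_def using binomial_small_le assms(1) by (intro sum_mono mult_left_mono) auto
  also have "\<dots> = 2 * real m ^ 2 / real (n - m) * real (n choose (n div 2))"
    by (simp add: c_def power2_eq_square)
  finally show ?thesis .
qed

context two_level_poset
begin

lemma La_le:
  assumes m: "d < m" "2 * card P \<le> m" "m < n"
  shows "real (La n P r) / real (n choose (n div 2)) \<le>
    2 - 1 / (2 * (real (d choose l) + real (d choose (l + 1)) - 1)) + 14 * card P / m + 2 * real m ^ 2 / real (n - m)"
proof -
  define Fs where "Fs = {F. F \<subseteq> Pow {1..n} \<and> poset_free P r F}"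
  define c where "c = real (n choose (n div 2))"
  have c: "c > 0" by (simp add: c_def zero_less_binomial_iff)
  \<comment> \<open>For nonempty \<open>P\<close> the empty family is free of \<open>P\<close>, so
    the maximum in \<open>La\<close> ranges over a nonempty set and is attained.\<close>
  have "\<not> weak_copy P r {}" using P_nonempty by (auto simp: weak_copy_def bij_betw_def)
  then have "{} \<in> Fs" by (auto simp: Fs_def poset_free_def)
  moreover have "finite Fs" unfolding Fs_def by (rule finite_subset[of _ "Pow (Pow {1..n})"]) auto
  moreover have "La n P r = Max (card ` Fs)"
    unfolding La_def Fs_def by (rule arg_cong[where f = Max]) auto
  ultimately have "La n P r \<in> card ` Fs" by (metis Max_in empty_iff finite_imageI image_is_empty)
  then obtain F where F: "F \<subseteq> Pow {1..n}" "poset_free P r F" "La n P r = card F"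
    by (auto simp: Fs_def)
  define G where "G = {B\<in>F. m \<le> card B \<and> card B + m \<le> n}"
  have finF: "finite F" using F(1) finite_subset by blast
  have "lubell n G \<le> 2 - 1 / (2 * (real (d choose l) + real (d choose (l + 1)) - 1)) + 14 * card P / m"
    by (rule lubell_le) (use F m in \<open>auto simp: G_def poset_free_def\<close>)
  then have "real (card G) \<le> c * (2 - 1 / (2 * (real (d choose l) + real (d choose (l + 1)) - 1)) + 14 * card P / m)"
    using card_le_lubell[of G n] F(1) c unfolding c_def
    by (smt (verit) G_def mem_Collect_eq mult_left_mono subset_iff)
  moreover have "real (card (F - G)) \<le> 2 * real m ^ 2 / real (n - m) * c"
    unfolding c_def by (rule card_extreme_le) (use F m in \<open>auto simp: G_def\<close>)
  moreover have "card F = card G + card (F - G)"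
    using finF by (subst card_Un_disjoint[symmetric]) (auto simp: G_def intro: arg_cong[where f = card])
  ultimately have "real (card F) \<le> (2 - 1 / (2 * (real (d choose l) + real (d choose (l + 1)) - 1)) + 14 * card P / m
      + 2 * real m ^ 2 / real (n - m)) * c"
    by (simp add: algebra_simps)
  then show ?thesis using c by (simp add: F(3) c_def[symmetric] divide_le_eq)
qed

lemma pi_plus_le:
  "pi_plus P r \<le> ereal (2 - 1 / (2 * (real (d choose l) + real (d choose (l + 1)) - 1)))"
proof (rule ereal_le_epsilon2)
  fix \<epsilon> :: real assume \<epsilon>: "\<epsilon> > 0"
  define \<delta> where "\<delta> = 1 / (2 * (real (d choose l) + real (d choose (l + 1)) - 1))"
  obtain m0 :: nat where m0: "28 * real (card P) / \<epsilon> < real m0" using reals_Archimedean2 by blast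
  \<comment> \<open>First \<open>m\<close> is fixed to make the nesting error at most
    \<open>\<epsilon> / 2\<close>; then \<open>n\<close> is taken large so that the extreme layers
    cost at most \<open>\<epsilon> / 2\<close>.\<close>
  define m where "m = m0 + d + 2 * card P + 1"
  have "28 * real (card P) / \<epsilon> < real m" using m0 by (simp add: m_def)
  then have m: "14 * real (card P) / real m \<le> \<epsilon> / 2"
    using \<epsilon> by (simp add: m_def field_simps)
  obtain n0 :: nat where n0: "4 * real m ^ 2 / \<epsilon> < real n0" using reals_Archimedean2 by blast
  have "ereal (real (La n P r) / real (n choose (n div 2))) \<le> ereal (2 - \<delta>) + ereal \<epsilon>"
    if n: "n \<ge> n0 + m + 1" for n
  proof -
    have pos: "real (n - m) > 0" using n by simp
    have "4 * real m ^ 2 / \<epsilon> < real (n - m)" using n0 n by linarith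
    then have "2 * real m ^ 2 / real (n - m) \<le> \<epsilon> / 2"
      using \<epsilon> pos by (simp add: field_simps)
    then show ?thesis
      using La_le[of m n] m n by (simp add: m_def \<delta>_def)
  qed
  then show "pi_plus P r \<le> ereal (2 - 1 / (2 * (real (d choose l) + real (d choose (l + 1)) - 1))) + ereal \<epsilon>"
    unfolding pi_plus_def \<delta>_def[symmetric]
    by (intro Limsup_bounded) (auto simp: eventually_sequentially)
qed

end

section \<open>Consequences of \<open>e_poset P r = 1\<close>\<close>

lemma weak_copy_down_sets:
  assumes "finite P" "partial_order_on P r" "card P \<le> n"
  shows "\<exists>G\<subseteq>Pow {1..n}. weak_copy P r G"
proof -
  obtain g where g: "g ` P \<subseteq> {1..n}" "inj_on g P"
    using card_le_inj[OF assms(1), of "{1..n}"] assms(3) by auto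
  \<comment> \<open>Principal down-sets, with the points of \<open>P\<close> labelled by
    \<open>g\<close>. Transitivity makes the map monotone; reflexivity and antisymmetry make it
    injective.\<close>
  define \<psi> where "\<psi> p = g ` {q\<in>P. (q, p) \<in> r}" for p
  have refl: "(p, p) \<in> r" if "p \<in> P" for p
    using assms(2) that by (auto simp: partial_order_on_def preorder_on_def refl_on_def)
  have trans: "trans r" and antisym: "antisym r"
    using assms(2) by (auto simp: partial_order_on_def preorder_on_def)
  have "inj_on \<psi> P"
  proof (rule inj_onI)
    fix p q assume pq: "p \<in> P" "q \<in> P" "\<psi> p = \<psi> q"
    then have "{x\<in>P. (x, p) \<in> r} = {x\<in>P. (x, q) \<in> r}"
      unfolding \<psi>_def using inj_on_image_eq_iff[OF g(2)] by (metis (no_types, lifting) mem_Collect_eq subsetI)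
    then have "(p, q) \<in> r" "(q, p) \<in> r" using pq refl by blast+
    then show "p = q" using antisym by (auto dest: antisymD)
  qed
  moreover have "\<psi> p \<subseteq> \<psi> q" if "(p, q) \<in> r" for p q
    using that trans by (auto simp: \<psi>_def dest: transD)
  ultimately have "weak_copy P r (\<psi> ` P)" unfolding weak_copy_def bij_betw_def by blast
  moreover have "\<psi> ` P \<subseteq> Pow {1..n}" using g(1) by (auto simp: \<psi>_def)
  ultimately show ?thesis by blast
qed

lemma e_poset_eq_1D:
  assumes "finite P" "partial_order_on P r" "e_poset P r = 1"
  shows "P \<noteq> {}" and "\<exists>d l. l < d \<and> embeds_in_levels P r d l"
proof -
  define X where "X = {k. \<forall>n s. s + k \<le> n + 1 \<longrightarrow> poset_free P r (\<Union>i\<in>{s..<s + k}. layer n i)}"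
  have SupX: "Sup X = 1" using assms(3) by (simp add: e_poset_def X_def)
  \<comment> \<open>For the empty poset no \<open>k\<close> qualifies, and \<open>Sup\<close> of the
    empty set of naturals is 0 rather than 1.\<close>
  show nonempty: "P \<noteq> {}"
  proof
    assume "P = {}"
    then have "weak_copy P r ({} :: nat set set)" by (auto simp: weak_copy_def bij_betw_def)
    then have "\<not> poset_free P r F" for F :: "nat set set" by (auto simp: poset_free_def)
    then have "k \<notin> X" for k
      unfolding X_def by (metis (no_types, lifting) add_0 le_add1 mem_Collect_eq)
    then have "X = {}" by blast
    then show False using SupX by (simp add: Sup_nat_def)
  qed
  \<comment> \<open>For \<open>k > card P\<close>, the \<open>k\<close> layers of the cube on
    \<open>k - 1\<close> points are the whole cube, which contains the down-set copy. Boundedness is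
    what makes \<open>Sup X\<close> an upper bound of \<open>X\<close>, so that
    \<open>2 \<notin> X\<close> follows.\<close>
  have "k \<le> card P" if k: "k \<in> X" for k
  proof (rule ccontr)
    assume "\<not> k \<le> card P"
    then have "card P \<le> k - 1" by simp
    then obtain G where G: "G \<subseteq> Pow {1..k - 1}" "weak_copy P r G"
      using weak_copy_down_sets[OF assms(1,2)] by blast
    have "G \<subseteq> (\<Union>i\<in>{0..<0 + k}. layer (k - 1) i)"
    proof
      fix B assume "B \<in> G"
      then have "B \<subseteq> {1..k - 1}" using G by auto
      moreover from this have "card B \<le> k - 1" using card_mono[of "{1..k - 1}" B] by simp
      ultimately show "B \<in> (\<Union>i\<in>{0..<0 + k}. layer (k - 1) i)"
        using \<open>\<not> k \<le> card P\<close> by (auto simp: layer_def)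
    qed
    moreover have "poset_free P r (\<Union>i\<in>{0..<0 + k}. layer (k - 1) i)"
      using k[unfolded X_def mem_Collect_eq, THEN spec, THEN spec, THEN mp, of 0 "k - 1"] by simp
    ultimately show False using G(2) by (auto simp: poset_free_def)
  qed
  then have "bdd_above X" by (rule bdd_aboveI)
  then have "2 \<notin> X" using cSup_upper[of 2 X] SupX by auto
  then obtain n s where ns: "s + 2 \<le> n + 1" "\<not> poset_free P r (\<Union>i\<in>{s..<s + 2}. layer n i)"
    by (auto simp: X_def)
  then obtain G \<psi> where G: "G \<subseteq> (\<Union>i\<in>{s..<s + 2}. layer n i)" "bij_betw \<psi> P G"
    "\<forall>p\<in>P. \<forall>q\<in>P. (p, q) \<in> r \<longrightarrow> \<psi> p \<subseteq> \<psi> q"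
    unfolding poset_free_def weak_copy_def by blast
  have "{s..<s + 2} = {s, s + 1}" by auto
  then have "\<psi> ` P \<subseteq> layer n s \<union> layer n (s + 1)" using G(1,2) by (auto simp: bij_betw_def)
  then have "embeds_in_levels P r n s"
    unfolding embeds_in_levels_def using G(2,3) by (auto simp: bij_betw_def)
  \<comment> \<open>The condition \<open>s + 2 \<le> n + 1\<close> on two consecutive layers is
    exactly \<open>s < n\<close>.\<close>
  then show "\<exists>d l. l < d \<and> embeds_in_levels P r d l" using ns(1) by (intro exI[of _ n] exI[of _ s]) auto
qed

theorem theorem3:
  fixes P :: "'a set" and r :: "'a rel"
  assumes "finite P" and "partial_order_on P r" and "e_poset P r = 1"
  shows "(\<exists>\<delta>::real. \<delta> > 0 \<and> pi_plus P r \<le> ereal (2 - \<delta>)) \<and>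
    (\<forall>d l. l < d \<and> embeds_in_levels P r d l \<longrightarrow>
      (let \<delta> = 1 / (2 * (real (d choose l) + real (d choose (l + 1)) - 1))
       in \<delta> > 0 \<and> pi_plus P r \<le> ereal (2 - \<delta>)))"
proof -
  define \<delta> where "\<delta> d l = 1 / (2 * (real (d choose l) + real (d choose (l + 1)) - 1))" for d l
  have main: "\<delta> d l > 0 \<and> pi_plus P r \<le> ereal (2 - \<delta> d l)" if dl: "l < d" "embeds_in_levels P r d l" for d l
  proof
    have "d choose l \<ge> 1" "d choose (l + 1) \<ge> 1"
      using dl(1) by (auto simp: Suc_le_eq zero_less_binomial_iff)
    then show "\<delta> d l > 0" by (simp add: \<delta>_def)
    obtain \<phi> where "inj_on \<phi> P" "\<phi> ` P \<subseteq> layer d l \<union> layer d (l + 1)"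
      "\<forall>p\<in>P. \<forall>q\<in>P. (p, q) \<in> r \<longrightarrow> \<phi> p \<subseteq> \<phi> q"
      using dl(2) by (auto simp: embeds_in_levels_def)
    then interpret two_level_poset P r d l \<phi>
      using assms(1) e_poset_eq_1D(1)[OF assms] dl(1) by unfold_locales auto
    show "pi_plus P r \<le> ereal (2 - \<delta> d l)"
      unfolding \<delta>_def by (rule pi_plus_le)
  qed
  then show ?thesis
    using e_poset_eq_1D(2)[OF assms] unfolding Let_def \<delta>_def by blast
qed

end
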